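(* Let $\mu=\mu^{\mathrm{RC}}_{E,\boldsymbol p,\boldsymbol\lambda}$ be the distribution of the random cluster model specified by a graph $G=(V,E)$ with $n=|V|$, $m=|E|$, and parameters $\boldsymbol p\in(0,1)^E$ and $\boldsymbol\lambda\in(0,1)^V$. Let $p_{\min}=\min_{e\in E}p_e$, $\lambda_{\max}=\max_{v\in V}\lambda_v$ and $K:=(1-p_{\min})\log n$. Let $\epsilon\in(0,\tfrac14)$. If $$K\le\min\Bigl\{10^{-7},\ \frac{1-\lambda_{\max}}{27}\Bigr\},$$ then the mixing time of the Glauber dynamics for $\mu$ satisfies $$T_{\mathrm{mix}}(\epsilon)\le 25\,m\log m\,\log(1/\epsilon)+1.$$ Furthermore, if $$K\le\min\Bigl\{10^{-5}\exp\Bigl(-\frac{\log(8/\epsilon)}{\log n}\Bigr),\ \frac{1-\lambda_{\max}}{27}\Bigr\},$$ then the mixing time of the Glauber dynamics for $\mu$ initialized from $E$ satisfies $$T_{\mathrm{mix}}(\epsilon,E)\le 2m\bigl(\log m+\log(2/\epsilon)\bigr).$$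
   Context: Graphs are finite, undirected and simple, with $E\neq\emptyset$ so that $p_{\min}$ is defined; $\log$ is the natural logarithm. The random cluster model is the distribution over subsets $S\subseteq E$ with $\mu^{\mathrm{RC}}_{E,\boldsymbol p,\boldsymbol\lambda}(S)=w(S)/\sum_{T\subseteq E}w(T)$, where $$w(S)=\prod_{e\in S}p_e\prod_{f\in E\setminus S}(1-p_f)\prod_{C\in\kappa(V,S)}\Bigl(1+\prod_{j\in C}\lambda_j\Bigr),$$ and $\kappa(V,S)$ is the set of connected components (as vertex sets) of $(V,S)$. The Glauber dynamics for $\mu$ is the Markov chain on $2^E$ that, from the current configuration $X$, picks $e\in E$ uniformly at random and resamples the status of $e$ from $\mu$ conditioned on agreeing with $X$ on $E\setminus\{e\}$; i.e. it moves to $X\cup\{e\}$ with probability $\frac{\mu(X\cup\{e\})}{\mu(X\cup\{e\})+\mu(X\setminus\{e\})}$ and to $X\setminus\{e\}$ otherwise. For a chain with transition matrix $P$ and stationary distribution $\mu$, $T_{\mathrm{mix}}(\epsilon,X_0)=\min\{t\in\mathbb N: d_{\mathrm{TV}}(P^t(X_0,\cdot),\mu)<\epsilon\}$ and $T_{\mathrm{mix}}(\epsilon)=\max_{X_0}T_{\mathrm{mix}}(\epsilon,X_0)$, with $d_{\mathrm{TV}}$ the total variation distance. *)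

theory Defs
  imports "HOL-Probability.Probability"
begin

definition simple_graph :: "'v set \<Rightarrow> 'v set set \<Rightarrow> bool" where
  "simple_graph V E \<longleftrightarrow> finite V \<and> (\<forall>e\<in>E. e \<subseteq> V \<and> card e = 2)"

definition connected_in :: "'v set \<Rightarrow> 'v set set \<Rightarrow> ('v \<times> 'v) set" where
  "connected_in V S = {(u, v). u \<in> V \<and> v \<in> V \<and> (u, v) \<in> {(x, y). {x, y} \<in> S}\<^sup>*}"

text \<open>Components are vertex sets; an isolated vertex is a singleton component.\<close>

definition graph_components :: "'v set \<Rightarrow> 'v set set \<Rightarrow> 'v set set" where
  "graph_components V S = V // connected_in V S"

definition rc_weight ::
  "'v set \<Rightarrow> 'v set set \<Rightarrow> ('v set \<Rightarrow> real) \<Rightarrow> ('v \<Rightarrow> real) \<Rightarrow> 'v set set \<Rightarrow> real" where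
  "rc_weight V E p lam S =
     (\<Prod>e\<in>S. p e) * (\<Prod>f\<in>E - S. 1 - p f) * (\<Prod>C\<in>graph_components V S. 1 + (\<Prod>j\<in>C. lam j))"

text \<open>The mass function passed to \<^const>\<open>embed_pmf\<close> is normalised under the hypotheses of
  the lemma \<open>pmf_random_cluster\<close> below.\<close>

definition random_cluster ::
  "'v set \<Rightarrow> 'v set set \<Rightarrow> ('v set \<Rightarrow> real) \<Rightarrow> ('v \<Rightarrow> real) \<Rightarrow> 'v set set pmf" where
  "random_cluster V E p lam =
     embed_pmf (\<lambda>S. if S \<subseteq> E then rc_weight V E p lam S / (\<Sum>T\<in>Pow E. rc_weight V E p lam T) else 0)"

lemma finite_edges: "simple_graph V E \<Longrightarrow> finite E"
  unfolding simple_graph_def by (rule finite_subset[of E "Pow V"]) auto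

lemma rc_weight_pos:
  assumes "simple_graph V E" "\<And>e. e \<in> E \<Longrightarrow> 0 < p e \<and> p e < 1"
    "\<And>v. v \<in> V \<Longrightarrow> 0 < lam v" "S \<subseteq> E"
  shows "0 < rc_weight V E p lam S"
proof -
  have "C \<subseteq> V" if "C \<in> graph_components V S" for C
    using that by (auto simp: graph_components_def quotient_def connected_in_def)
  then have "0 < 1 + (\<Prod>j\<in>C. lam j)" if "C \<in> graph_components V S" for C
    using assms(3) that by (intro add_pos_nonneg prod_nonneg) (auto intro: less_imp_le)
  moreover have "0 < p e" if "e \<in> S" for e using assms(2,4) that by auto
  moreover have "0 < 1 - p e" if "e \<in> E - S" for e using assms(2) that by auto
  ultimately show ?thesis
    unfolding rc_weight_def by (intro mult_pos_pos prod_pos) auto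
qed

lemma pmf_random_cluster:
  assumes "simple_graph V E" "\<And>e. e \<in> E \<Longrightarrow> 0 < p e \<and> p e < 1"
    "\<And>v. v \<in> V \<Longrightarrow> 0 < lam v"
  shows "pmf (random_cluster V E p lam) S =
    (if S \<subseteq> E then rc_weight V E p lam S / (\<Sum>T\<in>Pow E. rc_weight V E p lam T) else 0)"
proof -
  let ?Z = "\<Sum>T\<in>Pow E. rc_weight V E p lam T"
  let ?f = "\<lambda>S. if S \<subseteq> E then rc_weight V E p lam S / ?Z else 0"
  have fin: "finite (Pow E)" using finite_edges[OF assms(1)] by simp
  have w: "0 < rc_weight V E p lam T" if "T \<in> Pow E" for T
    using rc_weight_pos[of V E p lam T] assms that by auto
  have Z: "0 < ?Z" using fin w by (intro sum_pos) auto
  have nn: "0 \<le> ?f T" for T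
    using Z w[of T] by (auto intro!: divide_nonneg_pos less_imp_le)
  have "(\<integral>\<^sup>+T. ennreal (?f T) \<partial>count_space UNIV) = (\<Sum>T\<in>Pow E. ennreal (?f T))"
    using fin by (intro nn_integral_count_space') auto
  also have "\<dots> = ennreal (\<Sum>T\<in>Pow E. ?f T)"
    by (rule sum_ennreal) (rule nn)
  also have "(\<Sum>T\<in>Pow E. ?f T) = (\<Sum>T\<in>Pow E. rc_weight V E p lam T / ?Z)"
    by (rule sum.cong) auto
  also have "\<dots> = 1" using Z by (simp flip: sum_divide_distrib)
  finally have "(\<integral>\<^sup>+T. ennreal (?f T) \<partial>count_space UNIV) = 1" by simp
  then show ?thesis
    unfolding random_cluster_def using pmf_embed_pmf[of ?f] nn by simp
qed

definition glauber :: "'e set \<Rightarrow> 'e set pmf \<Rightarrow> 'e set \<Rightarrow> 'e set pmf" where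
  "glauber E \<mu> X =
     do {
       e \<leftarrow> pmf_of_set E;
       b \<leftarrow> bernoulli_pmf (pmf \<mu> (X \<union> {e}) / (pmf \<mu> (X \<union> {e}) + pmf \<mu> (X - {e})));
       return_pmf (if b then X \<union> {e} else X - {e})
     }"

definition chain_dist :: "('s \<Rightarrow> 's pmf) \<Rightarrow> nat \<Rightarrow> 's \<Rightarrow> 's pmf" where
  "chain_dist P t x = ((\<lambda>\<nu>. bind_pmf \<nu> P) ^^ t) (return_pmf x)"

definition tv_dist :: "'s pmf \<Rightarrow> 's pmf \<Rightarrow> real" where
  "tv_dist \<nu> \<mu> = (SUP A. \<bar>measure_pmf.prob \<nu> A - measure_pmf.prob \<mu> A\<bar>)"

text \<open>Mixing times are extended naturals: if the distance never drops below \<open>\<epsilon>\<close>, the infimum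
  of the empty set is \<open>\<infinity>\<close>. Otherwise the infimum is attained, hence a minimum, and over a
  finite nonempty state space the supremum is a maximum.\<close>

definition mixing_time_from :: "('s \<Rightarrow> 's pmf) \<Rightarrow> 's pmf \<Rightarrow> real \<Rightarrow> 's \<Rightarrow> enat" where
  "mixing_time_from P \<mu> \<epsilon> x = (INF t\<in>{t. tv_dist (chain_dist P t x) \<mu> < \<epsilon>}. enat t)"

definition mixing_time :: "'s set \<Rightarrow> ('s \<Rightarrow> 's pmf) \<Rightarrow> 's pmf \<Rightarrow> real \<Rightarrow> enat" where
  "mixing_time \<Omega> P \<mu> \<epsilon> = (SUP x\<in>\<Omega>. mixing_time_from P \<mu> \<epsilon> x)"

end

theory Submission
  imports Defs
begin

text \<open>
  Given the other edges, the edge \<open>e\<close> is present with probability \<open>p / (p + (1 - p) * (1 + c))\<close>, where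
  \<open>c\<close> is \<open>0\<close> if the endpoints of \<open>e\<close> are connected without it, and \<open>(a + b) / (1 + a * b)\<close> if \<open>e\<close>
  joins components of weights \<open>a\<close> and \<open>b\<close>. This is monotone in the configuration, so the dynamics
  has a monotone coupling of a larger chain \<open>X\<close> and a smaller chain \<open>Y\<close>. Let \<open>d\<close> be the number of
  edges in \<open>X - Y\<close>; a step contracts \<open>d\<close> by \<open>1 - 1/m\<close>, up to \<open>1/m\<close> times the sum of the
  differences of the update probabilities.

  Adding one edge \<open>{u, v}\<close> to \<open>Y\<close> changes the cost \<open>c\<close> of \<open>f\<close> by at most the weight of the
  component of \<open>u\<close> in \<open>Y - {f}\<close>, provided that \<open>f\<close> leaves this component, plus the same for \<open>v\<close>. Let
  \<open>L\<close> be the largest \<open>\<lambda>\<close>, so that a component of size \<open>s\<close> has weight at most \<open>L^s\<close>. The edges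
  \<open>f \<in> Y\<close> contribute at most \<open>1/(1 - L)\<close>, because at most \<open>s\<close> of them have a component of size at
  most \<open>s\<close>. The edges outside \<open>Y\<close> that count leave the component of \<open>u\<close> in \<open>Y\<close>; they contribute at most
  \<open>4 ln n/(1 - L)\<close> unless some vertex set \<open>A\<close> has more than \<open>4 |A| ln n\<close> boundary edges, all of them
  absent from \<open>Y\<close>. Outside this event the assumption on \<open>K\<close> keeps half of the contraction of \<open>d\<close>.
  Under \<open>\<mu>\<close>, and after \<open>3m\<close> steps from any start, the absence of a set of \<open>k\<close> edges has probability
  at most \<open>x^k\<close> with \<open>x\<close> small, so a union bound over \<open>A\<close> makes the event negligible.

  From the full configuration, couple with a stationary chain. From an arbitrary start, couple with
  the chain from \<open>E\<close> to see that \<open>O(m ln m)\<close> steps shrink the oscillation of every function by \<open>1/e\<close>,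
  and iterate.
\<close>

section \<open>Heat-bath operators and the monotone coupling\<close>

text \<open>The transition matrix acting on observables: the expectation of \<open>f\<close> one
  step after \<open>X\<close>. Iterates of this operator take the place of random
  trajectories.\<close>

definition heat_bath :: "'e set \<Rightarrow> ('e \<Rightarrow> 'e set \<Rightarrow> real) \<Rightarrow> ('e set \<Rightarrow> real) \<Rightarrow> 'e set \<Rightarrow> real" where
  "heat_bath E \<pi> f X =
     (\<Sum>e\<in>E. \<pi> e X * f (insert e X) + (1 - \<pi> e X) * f (X - {e})) / real (card E)"

text \<open>For \<open>Y \<subseteq> X\<close> both chains pick the same edge and compare the same
  uniform number with their update probabilities. The three terms are: present in both, present in
  \<open>X\<close> only, absent in both. Containment therefore survives every step.\<close>

definition coupled_heat_bath ::
  "'e set \<Rightarrow> ('e \<Rightarrow> 'e set \<Rightarrow> real) \<Rightarrow> ('e set \<Rightarrow> 'e set \<Rightarrow> real) \<Rightarrow> 'e set \<Rightarrow> 'e set \<Rightarrow> real" where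
  "coupled_heat_bath E \<pi> h X Y =
     (\<Sum>e\<in>E. \<pi> e Y * h (insert e X) (insert e Y) + (\<pi> e X - \<pi> e Y) * h (insert e X) (Y - {e})
        + (1 - \<pi> e X) * h (X - {e}) (Y - {e})) / real (card E)"

locale monotone_heat_bath =
  fixes E :: "'e set" and \<pi> :: "'e \<Rightarrow> 'e set \<Rightarrow> real"
  assumes finite_E: "finite E" and E_ne: "E \<noteq> {}"
    and prob_nonneg: "\<And>e X. e \<in> E \<Longrightarrow> X \<subseteq> E \<Longrightarrow> 0 \<le> \<pi> e X"
    and prob_le_1: "\<And>e X. e \<in> E \<Longrightarrow> X \<subseteq> E \<Longrightarrow> \<pi> e X \<le> 1"
    and prob_mono: "\<And>e X Y. e \<in> E \<Longrightarrow> Y \<subseteq> X \<Longrightarrow> X \<subseteq> E \<Longrightarrow> \<pi> e Y \<le> \<pi> e X"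
begin

abbreviation "G \<equiv> heat_bath E \<pi>"
abbreviation "Q \<equiv> coupled_heat_bath E \<pi>"

lemma card_E_pos: "0 < real (card E)"
  using finite_E E_ne by (simp add: card_gt_0_iff)

lemma G_add: "G (\<lambda>X. f X + g X) = (\<lambda>X. G f X + G g X)"
  unfolding heat_bath_def add_divide_distrib[symmetric] sum.distrib[symmetric]
  by (intro ext arg_cong2[where f = "(/)"] sum.cong) (auto simp: algebra_simps)

lemma G_cmult: "G (\<lambda>X. c * f X) = (\<lambda>X. c * G f X)"
  unfolding heat_bath_def
  by (rule ext) (simp add: algebra_simps sum_distrib_left)

lemma G_const: "G (\<lambda>X. c) = (\<lambda>X. c)"
  unfolding heat_bath_def using card_E_pos by (auto simp: algebra_simps)

lemma G_sum: "G (\<lambda>X. \<Sum>i\<in>I. f i X) = (\<lambda>X. \<Sum>i\<in>I. G (f i) X)"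
proof (induction I rule: infinite_finite_induct)
  case (insert i I)
  then show ?case by (simp add: G_add)
qed (simp_all add: G_const)

lemma G_mono:
  assumes "\<And>X. X \<subseteq> E \<Longrightarrow> f X \<le> g X" "X \<subseteq> E"
  shows "G f X \<le> G g X"
  unfolding heat_bath_def
  using assms(2) prob_nonneg[of _ X] prob_le_1[of _ X]
  by (intro divide_right_mono sum_mono add_mono mult_left_mono assms(1)) auto

lemma G_iter_mono:
  assumes "\<And>X. X \<subseteq> E \<Longrightarrow> f X \<le> g X" "X \<subseteq> E"
  shows "(G ^^ t) f X \<le> (G ^^ t) g X"
  using assms(2) by (induction t arbitrary: X) (auto intro: assms(1) G_mono)

lemma G_iter_add: "(G ^^ t) (\<lambda>X. f X + g X) = (\<lambda>X. (G ^^ t) f X + (G ^^ t) g X)"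
  by (induction t) (simp_all add: G_add)

lemma G_iter_cmult: "(G ^^ t) (\<lambda>X. c * f X) = (\<lambda>X. c * (G ^^ t) f X)"
  by (induction t) (simp_all add: G_cmult)

lemma G_iter_sum: "(G ^^ t) (\<lambda>X. \<Sum>i\<in>I. f i X) = (\<lambda>X. \<Sum>i\<in>I. (G ^^ t) (f i) X)"
  by (induction t) (simp_all add: G_sum)

lemma Q_add: "Q (\<lambda>X Y. f X Y + g X Y) = (\<lambda>X Y. Q f X Y + Q g X Y)"
  unfolding coupled_heat_bath_def add_divide_distrib[symmetric] sum.distrib[symmetric]
  by (intro ext arg_cong2[where f = "(/)"] sum.cong) (auto simp: algebra_simps)

lemma Q_cmult: "Q (\<lambda>X Y. c * f X Y) = (\<lambda>X Y. c * Q f X Y)"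
  unfolding coupled_heat_bath_def
  by (intro ext) (simp add: algebra_simps sum_distrib_left)

lemma Q_mono:
  assumes "\<And>X Y. Y \<subseteq> X \<Longrightarrow> X \<subseteq> E \<Longrightarrow> f X Y \<le> g X Y" "Y \<subseteq> X" "X \<subseteq> E"
  shows "Q f X Y \<le> Q g X Y"
proof -
  have "Y \<subseteq> E" using assms by auto
  then show ?thesis
    unfolding coupled_heat_bath_def
    using assms prob_nonneg[of _ Y] prob_le_1[of _ X] prob_mono[of _ Y X]
    by (intro divide_right_mono sum_mono add_mono mult_left_mono assms(1)) auto
qed

lemma Q_fst: "Q (\<lambda>X Y. f X) = (\<lambda>X Y. G f X)"
  unfolding coupled_heat_bath_def heat_bath_def
  by (intro ext arg_cong2[where f = "(/)"] sum.cong) (auto simp: algebra_simps)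

lemma Q_snd: "Q (\<lambda>X Y. f Y) = (\<lambda>X Y. G f Y)"
  unfolding coupled_heat_bath_def heat_bath_def
  by (intro ext arg_cong2[where f = "(/)"] sum.cong) (auto simp: algebra_simps)

lemma Q_iter_mono:
  assumes "\<And>X Y. Y \<subseteq> X \<Longrightarrow> X \<subseteq> E \<Longrightarrow> f X Y \<le> g X Y" "Y \<subseteq> X" "X \<subseteq> E"
  shows "(Q ^^ t) f X Y \<le> (Q ^^ t) g X Y"
  using assms(2,3) by (induction t arbitrary: X Y) (auto intro: assms(1) Q_mono)

lemma Q_iter_add: "(Q ^^ t) (\<lambda>X Y. f X Y + g X Y) = (\<lambda>X Y. (Q ^^ t) f X Y + (Q ^^ t) g X Y)"
  by (induction t) (simp_all add: Q_add)

lemma Q_iter_cmult: "(Q ^^ t) (\<lambda>X Y. c * f X Y) = (\<lambda>X Y. c * (Q ^^ t) f X Y)"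
  by (induction t) (simp_all add: Q_cmult)

lemma Q_iter_fst: "(Q ^^ t) (\<lambda>X Y. f X) = (\<lambda>X Y. (G ^^ t) f X)"
  by (induction t) (simp_all add: Q_fst)

lemma Q_iter_snd: "(Q ^^ t) (\<lambda>X Y. f Y) = (\<lambda>X Y. (G ^^ t) f Y)"
  by (induction t) (simp_all add: Q_snd)

abbreviation D :: "'e set \<Rightarrow> 'e set \<Rightarrow> real" where
  "D X Y \<equiv> real (card (X - Y))"

text \<open>\<open>D\<close> is at least 1 as soon as \<open>X \<noteq> Y\<close>, so it dominates
  the indicator of disagreement. Both marginals of \<open>Q\<close> are \<open>G\<close>, which
  turns the difference of two expectations into one coupled expectation.\<close>

lemma coupling_diff_bound:
  assumes f: "\<And>X Y. X \<subseteq> E \<Longrightarrow> Y \<subseteq> E \<Longrightarrow> \<bar>f X - f Y\<bar> \<le> c" and "0 \<le> c"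
    and XY: "Y \<subseteq> X" "X \<subseteq> E"
  shows "\<bar>(G ^^ t) f X - (G ^^ t) f Y\<bar> \<le> c * (Q ^^ t) D X Y"
proof -
  have *: "\<bar>f X - f Y\<bar> \<le> c * D X Y" if "Y \<subseteq> X" "X \<subseteq> E" for X Y
  proof (cases "X = Y")
    case False
    then have "X - Y \<noteq> {}" "finite (X - Y)"
      using that finite_E finite_subset[of "X - Y" E] by auto
    then have "1 \<le> D X Y"
      using card_gt_0_iff[of "X - Y"] by simp
    then have "c * 1 \<le> c * D X Y"
      using \<open>0 \<le> c\<close> by (intro mult_left_mono)
    then show ?thesis using f[of X Y] that by fastforce
  qed simp
  have eq: "(Q ^^ t) (\<lambda>X Y. s * f X + (- s) * f Y) X Y = s * (G ^^ t) f X - s * (G ^^ t) f Y" for s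
    unfolding Q_iter_add Q_iter_cmult Q_iter_fst Q_iter_snd by simp
  have "s * (G ^^ t) f X - s * (G ^^ t) f Y \<le> c * (Q ^^ t) D X Y" if "s \<in> {1, - 1}" for s
  proof -
    have "(Q ^^ t) (\<lambda>X Y. s * f X + (- s) * f Y) X Y \<le> (Q ^^ t) (\<lambda>X Y. c * D X Y) X Y"
    proof (rule Q_iter_mono[OF _ XY])
      fix X Y assume "Y \<subseteq> X" "X \<subseteq> E"
      then show "s * f X + - s * f Y \<le> c * D X Y" using *[of Y X] that by auto
    qed
    then show ?thesis unfolding eq Q_iter_cmult .
  qed
  from this[of 1] this[of "-1"] show ?thesis by auto
qed

lemma Q_D:
  assumes "Y \<subseteq> X" "X \<subseteq> E"
  shows "Q D X Y = (1 - 1 / real (card E)) * D X Y + (\<Sum>e\<in>E. \<pi> e X - \<pi> e Y) / real (card E)"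
proof -
  have fin: "finite (X - Y)" using assms finite_E finite_subset by blast
  \<comment> \<open>Updating \<open>e\<close> first deletes it from the difference. It returns
    exactly when the update makes it present in \<open>X\<close> and absent in \<open>Y\<close>,
    which has probability \<open>\<pi> e X - \<pi> e Y\<close>.\<close>
  have upd: "\<pi> e Y * D (insert e X) (insert e Y) + (\<pi> e X - \<pi> e Y) * D (insert e X) (Y - {e})
        + (1 - \<pi> e X) * D (X - {e}) (Y - {e})
      = (D X Y - indicator (X - Y) e) + (\<pi> e X - \<pi> e Y)" for e
  proof -
    have "insert e X - insert e Y = X - Y - {e}" "X - {e} - (Y - {e}) = X - Y - {e}"
      "insert e X - (Y - {e}) = insert e (X - Y - {e})" by auto
    moreover have "real (card (X - Y - {e})) = D X Y - indicator (X - Y) e"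
    proof (cases "e \<in> X - Y")
      case True
      then have "card (X - Y) = Suc (card (X - Y - {e}))"
        using fin by (rule card.remove[rotated])
      then show ?thesis using True by simp
    qed (simp add: Diff_insert0)
    moreover have "real (card (insert e (X - Y - {e}))) = real (card (X - Y - {e})) + 1"
      using fin by (subst card_insert_disjoint) auto
    ultimately show ?thesis by (simp add: algebra_simps)
  qed
  have "(\<Sum>e\<in>E. indicator (X - Y) e :: real) = D X Y"
  proof -
    have "E \<inter> (X - Y) = X - Y" using assms by auto
    moreover have "(\<Sum>e\<in>E. indicator (X - Y) e :: real) = (\<Sum>e\<in>E \<inter> (X - Y). 1)"
      by (subst sum.inter_restrict[OF finite_E]) (auto simp: indicator_def intro!: sum.cong)
    ultimately show ?thesis by simp
  qed
  then have "Q D X Y = (real (card E) * D X Y - D X Y + (\<Sum>e\<in>E. \<pi> e X - \<pi> e Y)) / real (card E)"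
    unfolding coupled_heat_bath_def upd sum.distrib sum_subtractf by simp
  then show ?thesis using card_E_pos by (simp add: field_simps)
qed

text \<open>The error \<open>b\<close> depends on the lower chain alone, so after \<open>t\<close>
  coupled steps its expectation is a one-chain quantity, accessible through stationarity or through
  the decay of \<open>absent\<close>.\<close>

lemma Q_iter_D_Suc:
  assumes drift: "\<And>X Y. Y \<subseteq> X \<Longrightarrow> X \<subseteq> E \<Longrightarrow> Q D X Y \<le> \<alpha> * D X Y + b Y"
    and XY: "Y \<subseteq> X" "X \<subseteq> E"
  shows "(Q ^^ Suc t) D X Y \<le> \<alpha> * (Q ^^ t) D X Y + (G ^^ t) b Y"
proof -
  have "(Q ^^ Suc t) D X Y = (Q ^^ t) (Q D) X Y" by (simp add: funpow_swap1)
  also have "\<dots> \<le> (Q ^^ t) (\<lambda>X Y. \<alpha> * D X Y + b Y) X Y"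
    by (intro Q_iter_mono XY drift)
  also have "\<dots> = \<alpha> * (Q ^^ t) D X Y + (G ^^ t) b Y"
    unfolding Q_iter_add Q_iter_cmult Q_iter_snd ..
  finally show ?thesis .
qed

section \<open>Probability that all edges of a given set are absent\<close>

definition absent :: "'e set \<Rightarrow> 'e set \<Rightarrow> real" where
  "absent F Y = (if F \<inter> Y = {} then 1 else 0)"

text \<open>An update outside \<open>F\<close> does not affect \<open>absent F\<close>. After an
  update of \<open>e\<close> in \<open>F\<close>, absence requires that \<open>e\<close> was
  resampled as absent, which costs a factor \<open>q\<close>, and that the rest of \<open>F\<close>
  was absent already.\<close>

lemma G_absent_le:
  assumes q: "\<And>e X. e \<in> E \<Longrightarrow> X \<subseteq> E \<Longrightarrow> 1 - \<pi> e X \<le> q"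
    and F: "F \<subseteq> E" and X: "X \<subseteq> E"
  shows "G (absent F) X \<le> (1 - real (card F) / real (card E)) * absent F X
           + (\<Sum>e\<in>F. q * absent (F - {e}) X) / real (card E)"
proof -
  have finF: "finite F" using F finite_E finite_subset by blast
  have "(\<Sum>e\<in>E. \<pi> e X * absent F (insert e X) + (1 - \<pi> e X) * absent F (X - {e}))
      \<le> (\<Sum>e\<in>E. if e \<in> F then q * absent (F - {e}) X else absent F X)"
  proof (rule sum_mono)
    fix e assume e: "e \<in> E"
    show "\<pi> e X * absent F (insert e X) + (1 - \<pi> e X) * absent F (X - {e})
        \<le> (if e \<in> F then q * absent (F - {e}) X else absent F X)"
    proof (cases "e \<in> F")
      case True
      then have "absent F (insert e X) = 0" "absent F (X - {e}) = absent (F - {e}) X"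
        by (auto simp: absent_def)
      then show ?thesis using True q[OF e X] by (auto intro!: mult_right_mono simp: absent_def)
    next
      case False
      then have "absent F (insert e X) = absent F X" "absent F (X - {e}) = absent F X"
        by (auto simp: absent_def)
      then show ?thesis using False by (simp add: algebra_simps)
    qed
  qed
  also have "\<dots> = (\<Sum>e\<in>F. q * absent (F - {e}) X) + real (card E - card F) * absent F X"
  proof -
    have "E \<inter> {e. e \<in> F} = F" "E \<inter> - {e. e \<in> F} = E - F" using F by auto
    then show ?thesis using finite_E F finF by (simp add: sum.If_cases card_Diff_subset)
  qed
  also have "real (card E - card F) = real (card E) - real (card F)"
    using F finite_E by (simp add: card_mono of_nat_diff)
  finally have "G (absent F) X \<le> ((\<Sum>e\<in>F. q * absent (F - {e}) X)
      + (real (card E) - real (card F)) * absent F X) / real (card E)"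
    unfolding heat_bath_def by (intro divide_right_mono) auto
  then show ?thesis using card_E_pos by (simp add: field_simps)
qed

text \<open>Heuristically, an edge is absent at time \<open>t\<close> only if it was never picked or
  its last update left it absent, and the edges of \<open>F\<close> behave as if independent. The
  induction on \<open>t\<close> yields this product bound without any independence.\<close>

lemma G_iter_absent_le:
  assumes q: "\<And>e X. e \<in> E \<Longrightarrow> X \<subseteq> E \<Longrightarrow> 1 - \<pi> e X \<le> q" and q0: "0 \<le> q"
    and X: "X \<subseteq> E" and F: "F \<subseteq> E"
  shows "(G ^^ t) (absent F) X \<le> (q + (1 - 1 / real (card E)) ^ t) ^ card F"
  using F
proof (induction t arbitrary: F)
  case 0
  have "1 \<le> (q + 1) ^ card F" using q0 by (intro one_le_power) auto
  then show ?case by (auto simp: absent_def intro: order_trans)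
next
  case (Suc t)
  let ?m = "real (card E)" and ?k = "card F"
  \<comment> \<open>\<open>x\<close> is the base for time \<open>t\<close> and \<open>x + h\<close>
    the base for time \<open>t + 1\<close>. The one-step bound adds up to the tangent of the power
    function at \<open>x\<close>, evaluated at \<open>x + h\<close>; convexity bounds it by
    \<open>(x + h) ^ card F\<close>.\<close>
  define x where "x = q + (1 - 1 / ?m) ^ t"
  define h where "h = (q - x) / ?m"
  have m1: "1 \<le> ?m" using card_E_pos by simp
  have x0: "0 \<le> x" unfolding x_def using q0 m1 by (intro add_nonneg_nonneg zero_le_power) auto
  have xh: "q + (1 - 1 / ?m) ^ Suc t = x + h"
    using m1 by (simp add: x_def h_def field_simps)
  have xh0: "0 \<le> x + h" unfolding xh[symmetric] using q0 m1
    by (intro add_nonneg_nonneg zero_le_power) auto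
  have kF: "real ?k \<le> ?m" using Suc.prems finite_E by (simp add: card_mono)
  have "(G ^^ Suc t) (absent F) X = (G ^^ t) (G (absent F)) X" by (simp add: funpow_swap1)
  also have "\<dots> \<le> (G ^^ t) (\<lambda>X. (1 - real ?k / ?m) * absent F X
           + (1 / ?m) * (\<Sum>e\<in>F. q * absent (F - {e}) X)) X"
    by (rule G_iter_mono[OF _ X]) (use G_absent_le[OF q Suc.prems] in simp)
  also have "\<dots> = (1 - real ?k / ?m) * (G ^^ t) (absent F) X
           + (1 / ?m) * (\<Sum>e\<in>F. q * (G ^^ t) (absent (F - {e})) X)"
    unfolding G_iter_add G_iter_cmult G_iter_sum ..
  also have "\<dots> \<le> (1 - real ?k / ?m) * x ^ ?k + (1 / ?m) * (\<Sum>e\<in>F. q * x ^ (?k - 1))"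
  proof (intro add_mono mult_left_mono sum_mono)
    show "(G ^^ t) (absent F) X \<le> x ^ ?k" using Suc by (simp add: x_def)
    fix e assume "e \<in> F"
    then show "(G ^^ t) (absent (F - {e})) X \<le> x ^ (?k - 1)"
      using Suc.IH[of "F - {e}"] Suc.prems by (simp add: x_def subset_iff)
  qed (use q0 m1 kF in auto)
  also have "\<dots> = x ^ ?k + real ?k * x ^ (?k - 1) * h"
    by (cases ?k) (use m1 in \<open>auto simp: h_def field_simps\<close>)
  also have "\<dots> \<le> (x + h) ^ ?k"
  \<comment> \<open>Bernoulli's inequality is applied to \<open>h / x\<close>, so
    \<open>x = 0\<close> is treated apart; it occurs only for a single edge and
    \<open>q = 0\<close>.\<close>
  proof (cases "x = 0")
    case True
    then show ?thesis using xh0 by (cases ?k; cases "?k - 1") (auto simp: zero_power)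
  next
    case False
    then have "0 < x" using x0 by simp
    then have "-1 \<le> h / x" using xh0 by (simp add: field_simps)
    then have "1 + real ?k * (h / x) \<le> (1 + h / x) ^ ?k" by (rule Bernoulli_inequality)
    then have "x ^ ?k * (1 + real ?k * (h / x)) \<le> x ^ ?k * (1 + h / x) ^ ?k"
      using x0 by (intro mult_left_mono) auto
    also have "\<dots> = (x + h) ^ ?k"
      using \<open>0 < x\<close> by (simp add: power_mult_distrib[symmetric] field_simps)
    also have "x ^ ?k * (1 + real ?k * (h / x)) = x ^ ?k + real ?k * x ^ (?k - 1) * h"
      using \<open>0 < x\<close> by (cases ?k) (auto simp: field_simps)
    finally show ?thesis .
  qed
  finally show ?case unfolding xh .
qed

text \<open>Two arbitrary starts need not be comparable, but both lie below \<open>E\<close>.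
  Comparing each with the chain from \<open>E\<close> costs a factor 2 by the triangle inequality.
  Each block of \<open>t\<close> steps acts on the function produced by the previous blocks.\<close>

lemma oscillation_contraction:
  assumes contr: "\<And>X. X \<subseteq> E \<Longrightarrow> (Q ^^ t) D E X \<le> \<rho>"
    and f: "\<And>X Y. X \<subseteq> E \<Longrightarrow> Y \<subseteq> E \<Longrightarrow> \<bar>f X - f Y\<bar> \<le> c"
    and XY: "X \<subseteq> E" "Y \<subseteq> E"
  shows "\<bar>(G ^^ (k * t)) f X - (G ^^ (k * t)) f Y\<bar> \<le> (2 * \<rho>) ^ k * c"
  using XY
proof (induction k arbitrary: X Y)
  case 0
  then show ?case using f by simp
next
  case (Suc k)
  define g where "g = (G ^^ (k * t)) f"
  define c' where "c' = (2 * \<rho>) ^ k * c"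
  have g: "\<bar>g X - g Y\<bar> \<le> c'" if "X \<subseteq> E" "Y \<subseteq> E" for X Y
    using Suc.IH[OF that] by (simp add: g_def c'_def)
  have c': "0 \<le> c'" using g[of E E] by simp
  have gE: "\<bar>(G ^^ t) g E - (G ^^ t) g X\<bar> \<le> c' * \<rho>" if "X \<subseteq> E" for X
    using coupling_diff_bound[where f = g, OF g c' that order_refl, where t = t]
      mult_left_mono[OF contr[OF that] c'] by fastforce
  have "(G ^^ (Suc k * t)) f = (G ^^ t) g"
    by (simp add: g_def funpow_add)
  then have "\<bar>(G ^^ (Suc k * t)) f X - (G ^^ (Suc k * t)) f Y\<bar> \<le> 2 * (c' * \<rho>)"
    using gE[OF Suc.prems(1)] gE[OF Suc.prems(2)] by (simp add: abs_le_iff)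
  then show ?case by (simp add: c'_def mult_ac)
qed

end

section \<open>The Glauber dynamics in terms of the heat-bath operator\<close>

lemma expectation_glauber:
  fixes f :: "'e set \<Rightarrow> real"
  assumes "finite E" "E \<noteq> {}"
  shows "measure_pmf.expectation (glauber E \<mu> X) f =
    heat_bath E (\<lambda>e X. pmf \<mu> (X \<union> {e}) / (pmf \<mu> (X \<union> {e}) + pmf \<mu> (X - {e}))) f X"
proof -
  define \<pi> where "\<pi> e = pmf \<mu> (X \<union> {e}) / (pmf \<mu> (X \<union> {e}) + pmf \<mu> (X - {e}))" for e
  have \<pi>: "\<pi> e \<in> {0..1}" for e
    using pmf_nonneg[of \<mu> "X \<union> {e}"] pmf_nonneg[of \<mu> "X - {e}"]
    unfolding \<pi>_def atLeastAtMost_iff divide_le_eq_1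
    by (intro conjI divide_nonneg_nonneg add_nonneg_nonneg) linarith+
  have inner: "measure_pmf.expectation (bernoulli_pmf (\<pi> e) \<bind>
      (\<lambda>b. return_pmf (if b then X \<union> {e} else X - {e}))) f
      = \<pi> e * f (insert e X) + (1 - \<pi> e) * f (X - {e})" for e
    using \<pi>[of e] by (simp add: map_pmf_def[symmetric] integral_map_pmf)
  have "measure_pmf.expectation (glauber E \<mu> X) f
      = (\<Sum>e\<in>E. \<pi> e * f (insert e X) + (1 - \<pi> e) * f (X - {e})) / real (card E)"
    unfolding glauber_def \<pi>_def[symmetric]
    by (subst pmf_expectation_bind[where A = E])
      (use assms in \<open>auto simp: inner sum_divide_distrib\<close>)
  then show ?thesis by (simp add: heat_bath_def \<pi>_def)
qed

lemma set_pmf_glauber: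
  assumes "finite E" "E \<noteq> {}" "X \<subseteq> E"
  shows "set_pmf (glauber E \<mu> X) \<subseteq> Pow E"
  using assms unfolding glauber_def by (auto split: if_splits)

lemma set_pmf_chain_dist_glauber:
  assumes "finite E" "E \<noteq> {}" "X \<subseteq> E"
  shows "set_pmf (chain_dist (glauber E \<mu>) t X) \<subseteq> Pow E"
proof (induction t)
  case (Suc t)
  then show ?case
    using set_pmf_glauber[OF assms(1,2), of _ \<mu>] by (auto simp: chain_dist_def)
qed (use assms in \<open>auto simp: chain_dist_def\<close>)

text \<open>\<open>chain_dist\<close> appends its steps at the end, so the last step becomes the
  innermost application of the operator to \<open>f\<close>; hence the induction generalises over
  \<open>f\<close>.\<close>

lemma expectation_chain_dist_glauber:
  fixes f :: "'e set \<Rightarrow> real"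
  assumes "finite E" "E \<noteq> {}" "X \<subseteq> E"
  shows "measure_pmf.expectation (chain_dist (glauber E \<mu>) t X) f =
    (heat_bath E (\<lambda>e X. pmf \<mu> (X \<union> {e}) / (pmf \<mu> (X \<union> {e}) + pmf \<mu> (X - {e}))) ^^ t) f X"
    (is "_ = (?G ^^ t) f X")
proof (induction t arbitrary: f)
  case 0
  then show ?case by (simp add: chain_dist_def)
next
  case (Suc t)
  let ?C = "chain_dist (glauber E \<mu>) t X"
  have fin: "finite (Pow E)" using assms by simp
  have sub: "set_pmf ?C \<subseteq> Pow E" by (rule set_pmf_chain_dist_glauber[OF assms])
  have "measure_pmf.expectation (chain_dist (glauber E \<mu>) (Suc t) X) f
      = measure_pmf.expectation (?C \<bind> glauber E \<mu>) f"
    by (simp add: chain_dist_def)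
  also have "\<dots> = (\<Sum>Y\<in>Pow E. pmf ?C Y * ?G f Y)"
    using sub fin set_pmf_glauber[OF assms(1,2), of _ \<mu>] finite_subset[OF _ fin]
    by (subst pmf_expectation_bind[where A = "Pow E"])
      (auto simp: expectation_glauber[OF assms(1,2)])
  also have "\<dots> = measure_pmf.expectation ?C (?G f)"
    using sub fin by (subst integral_measure_pmf_real[where A = "Pow E"]) (auto simp: mult.commute)
  also have "\<dots> = (?G ^^ t) (?G f) X" by (rule Suc.IH)
  finally show ?case by (simp add: funpow_swap1)
qed

lemma tv_dist_le:
  assumes "\<And>A. \<bar>measure_pmf.expectation \<nu> (indicator A) - measure_pmf.expectation \<mu> (indicator A)\<bar> \<le> (c::real)"
  shows "tv_dist \<nu> \<mu> \<le> c"
  unfolding tv_dist_def using assms by (intro cSUP_least) auto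

lemma mixing_time_from_le:
  assumes "tv_dist (chain_dist P t x) \<mu> < \<epsilon>"
  shows "mixing_time_from P \<mu> \<epsilon> x \<le> enat t"
  unfolding mixing_time_from_def using assms by (intro INF_lower) auto

section \<open>Stationarity, and absent edges under the stationary weights\<close>

lemma sum_Pow_split:
  fixes g :: "'e set \<Rightarrow> real"
  assumes "finite E" "e \<in> E"
  shows "(\<Sum>S\<in>Pow E. g S) = (\<Sum>S\<in>Pow (E - {e}). g S + g (insert e S))"
proof -
  have E: "E = insert e (E - {e})" using assms by auto
  have inj: "inj_on (insert e) (Pow (E - {e}))" by (auto simp: inj_on_def)
  have "(\<Sum>S\<in>Pow E. g S) = (\<Sum>S\<in>Pow (E - {e}) \<union> insert e ` Pow (E - {e}). g S)"
    by (subst E, subst Pow_insert) simp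
  also have "\<dots> = (\<Sum>S\<in>Pow (E - {e}). g S) + (\<Sum>S\<in>insert e ` Pow (E - {e}). g S)"
    using assms by (intro sum.union_disjoint) auto
  finally show ?thesis by (simp add: sum.reindex[OF inj] sum.distrib)
qed

text \<open>For a fixed edge \<open>e\<close>, the sets \<open>S\<close> and
  \<open>insert e S\<close> have the same update probability, which splits their total weight in
  proportion to \<open>w\<close>. So an update of \<open>e\<close> preserves \<open>w\<close> on
  each such pair.\<close>

lemma heat_bath_stationary:
  fixes w f :: "'e set \<Rightarrow> real"
  assumes "finite E" and E_ne: "E \<noteq> {}" and w: "\<And>S. S \<subseteq> E \<Longrightarrow> 0 < w S"
    and \<pi>: "\<And>e X. e \<in> E \<Longrightarrow> X \<subseteq> E \<Longrightarrow> \<pi> e X = w (insert e X) / (w (insert e X) + w (X - {e}))"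
  shows "(\<Sum>X\<in>Pow E. w X * heat_bath E \<pi> f X) = (\<Sum>X\<in>Pow E. w X * f X)"
proof -
  let ?g = "\<lambda>e X. w X * (\<pi> e X * f (insert e X) + (1 - \<pi> e X) * f (X - {e}))"
  have one: "(\<Sum>X\<in>Pow E. ?g e X) = (\<Sum>X\<in>Pow E. w X * f X)" if e: "e \<in> E" for e
    unfolding sum_Pow_split[OF assms(1) e]
  proof (rule sum.cong)
    fix S assume S: "S \<in> Pow (E - {e})"
    then have [simp]: "S - {e} = S" "insert e S - {e} = S" by auto
    have pos: "0 < w S" "0 < w (insert e S)" using S e by (auto intro!: w)
    define c where "c = w (insert e S) / (w (insert e S) + w S)"
    have c: "c * (w (insert e S) + w S) = w (insert e S)" using pos by (simp add: c_def)
    have "\<pi> e S = c" "\<pi> e (insert e S) = c"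
      using S e by (subst \<pi>; auto simp: c_def)+
    then have "?g e S + ?g e (insert e S)
        = c * (w (insert e S) + w S) * f (insert e S) + (w (insert e S) + w S - c * (w (insert e S) + w S)) * f S"
      by (simp add: algebra_simps)
    then show "?g e S + ?g e (insert e S) = w S * f S + w (insert e S) * f (insert e S)"
      unfolding c by simp
  qed simp
  have "(\<Sum>X\<in>Pow E. w X * heat_bath E \<pi> f X) = (\<Sum>X\<in>Pow E. \<Sum>e\<in>E. ?g e X) / real (card E)"
    unfolding heat_bath_def sum_divide_distrib[of _ "Pow E"]
    by (simp add: sum_distrib_left[symmetric])
  also have "(\<Sum>X\<in>Pow E. \<Sum>e\<in>E. ?g e X) = (\<Sum>e\<in>E. \<Sum>X\<in>Pow E. ?g e X)"
    by (rule sum.swap)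
  also have "\<dots> = real (card E) * (\<Sum>X\<in>Pow E. w X * f X)"
    by (simp add: one)
  finally show ?thesis using assms by (simp add: card_gt_0_iff)
qed

lemma heat_bath_iter_stationary:
  fixes w f :: "'e set \<Rightarrow> real"
  assumes "finite E" "E \<noteq> {}" "\<And>S. S \<subseteq> E \<Longrightarrow> 0 < w S"
    and "\<And>e X. e \<in> E \<Longrightarrow> X \<subseteq> E \<Longrightarrow> \<pi> e X = w (insert e X) / (w (insert e X) + w (X - {e}))"
  shows "(\<Sum>X\<in>Pow E. w X * (heat_bath E \<pi> ^^ t) f X) = (\<Sum>X\<in>Pow E. w X * f X)"
  by (induction t) (simp_all add: heat_bath_stationary[OF assms])

text \<open>Given all other edges, an edge is absent with conditional probability at most
  \<open>q\<close>. Deleting the edges of \<open>F\<close> from the ground set one by one gathers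
  one factor \<open>q\<close> each.\<close>

lemma stationary_absent_le:
  fixes w :: "'e set \<Rightarrow> real"
  assumes "finite E" and w: "\<And>S. S \<subseteq> E \<Longrightarrow> 0 < w S" and q: "0 \<le> q"
    and \<pi>: "\<And>e S. e \<in> E \<Longrightarrow> S \<subseteq> E - {e} \<Longrightarrow> w S \<le> q * (w S + w (insert e S))"
    and F: "F \<subseteq> E"
  shows "(\<Sum>X\<in>Pow (E - F). w X) \<le> q ^ card F * (\<Sum>X\<in>Pow E. w X)"
proof -
  have "finite F" using F assms(1) finite_subset by blast
  then show ?thesis using F
  proof (induction F)
    case (insert e F)
    have e: "e \<in> E - F" and fin: "finite (E - F)" using insert assms(1) by auto
    have "(\<Sum>X\<in>Pow (E - insert e F). w X) \<le> (\<Sum>X\<in>Pow (E - F - {e}). q * (w X + w (insert e X)))"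
      using e by (subst Diff_insert) (auto intro!: sum_mono \<pi>)
    also have "\<dots> = q * (\<Sum>X\<in>Pow (E - F). w X)"
      by (simp add: sum_Pow_split[OF fin e] sum_distrib_left)
    also have "\<dots> \<le> q * (q ^ card F * (\<Sum>X\<in>Pow E. w X))"
      using insert q by (intro mult_left_mono) auto
    finally show ?case using insert by simp
  qed simp
qed

section \<open>Components after adding an edge\<close>

text \<open>The component without reference to the vertex set; \<open>graph_components_eq\<close>
  links it to \<open>graph_components\<close> when all edges lie in \<open>V\<close>.\<close>

definition comp_of :: "'v set set \<Rightarrow> 'v \<Rightarrow> 'v set" where
  "comp_of S u = {(x, y). {x, y} \<in> S}\<^sup>* `` {u}"

lemma comp_of_self: "u \<in> comp_of S u"
  by (simp add: comp_of_def)

lemma comp_of_step: "v \<in> comp_of S u \<Longrightarrow> {v, w} \<in> S \<Longrightarrow> w \<in> comp_of S u"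
  unfolding comp_of_def by (auto intro: rtrancl_into_rtrancl)

lemma comp_of_least:
  assumes "u \<in> C" "\<And>v w. v \<in> C \<Longrightarrow> v \<in> comp_of S u \<Longrightarrow> {v, w} \<in> S \<Longrightarrow> w \<in> C"
  shows "comp_of S u \<subseteq> C"
proof -
  have "v \<in> C \<and> v \<in> comp_of S u" if "(u, v) \<in> {(x, y). {x, y} \<in> S}\<^sup>*" for v
    using that
  proof (induction rule: rtrancl_induct)
    case base
    then show ?case using assms(1) comp_of_self by simp
  next
    case (step v w)
    then show ?case using assms(2)[of v w] comp_of_step[of v S u w] by simp
  qed
  then show ?thesis unfolding comp_of_def by blast
qed

lemma comp_of_sym: "v \<in> comp_of S u \<Longrightarrow> u \<in> comp_of S v"
proof -
  have "sym ({(x, y). {x, y} \<in> S}\<^sup>*)"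
    by (intro sym_rtrancl) (auto simp: sym_def insert_commute)
  then show "v \<in> comp_of S u \<Longrightarrow> u \<in> comp_of S v"
    by (auto simp: comp_of_def sym_def)
qed

lemma comp_of_eq: "v \<in> comp_of S u \<Longrightarrow> comp_of S v = comp_of S u"
proof -
  have "comp_of S v \<subseteq> comp_of S u" if "v \<in> comp_of S u" for u v
    using that unfolding comp_of_def by (auto intro: rtrancl_trans)
  then show "v \<in> comp_of S u \<Longrightarrow> comp_of S v = comp_of S u"
    using comp_of_sym by fastforce
qed

lemma comp_of_disjoint: "v \<notin> comp_of S u \<Longrightarrow> comp_of S u \<inter> comp_of S v = {}"
  using comp_of_eq[of _ S u] comp_of_eq[of _ S v] comp_of_self[of v S] by blast

lemma comp_of_mono: "S \<subseteq> T \<Longrightarrow> comp_of S u \<subseteq> comp_of T u"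
  by (rule comp_of_least) (auto intro: comp_of_self comp_of_step)

lemma comp_of_subset: "(\<And>e. e \<in> S \<Longrightarrow> e \<subseteq> V) \<Longrightarrow> u \<in> V \<Longrightarrow> comp_of S u \<subseteq> V"
  by (rule comp_of_least) fastforce+

lemma comp_of_insert:
  "comp_of (insert {x, y} S) u =
    (if u \<in> comp_of S x \<union> comp_of S y then comp_of S x \<union> comp_of S y else comp_of S u)"
proof -
  let ?T = "insert {x, y} S"
  have sub: "comp_of S z \<subseteq> comp_of ?T z" for z by (rule comp_of_mono) auto
  have xy: "comp_of ?T y = comp_of ?T x"
    by (rule comp_of_eq, rule comp_of_step[OF comp_of_self]) simp
  show ?thesis
  proof (cases "u \<in> comp_of S x \<union> comp_of S y")
    case True
    then have "comp_of ?T u = comp_of ?T x"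
      using comp_of_eq[of u ?T x] comp_of_eq[of u ?T y] sub[of x] sub[of y] xy by auto
    moreover have "comp_of ?T u \<subseteq> comp_of S x \<union> comp_of S y"
      by (rule comp_of_least[OF True])
        (auto simp: doubleton_eq_iff comp_of_self intro: comp_of_step)
    ultimately show ?thesis using True sub[of x] sub[of y] xy by auto
  next
    case False
    have "comp_of ?T u \<subseteq> comp_of S u"
    proof (rule comp_of_least[OF comp_of_self])
      fix v w assume v: "v \<in> comp_of S u" "{v, w} \<in> ?T"
      then have "v \<noteq> x" "v \<noteq> y" using False comp_of_sym[of _ S u] by auto
      then have "{v, w} \<in> S" using v by (auto simp: doubleton_eq_iff)
      then show "w \<in> comp_of S u" using v comp_of_step by fast
    qed
    then show ?thesis using False sub[of u] by auto
  qed
qed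

lemma graph_components_eq:
  assumes "\<And>e. e \<in> S \<Longrightarrow> e \<subseteq> V"
  shows "graph_components V S = comp_of S ` V"
proof -
  have "connected_in V S `` {u} = comp_of S u" if "u \<in> V" for u
    using comp_of_subset[OF assms that] that by (auto simp: connected_in_def comp_of_def)
  then show ?thesis by (auto simp: graph_components_def quotient_def)
qed

lemma graph_components_insert:
  assumes S: "\<And>e. e \<in> S \<Longrightarrow> e \<subseteq> V" and xy: "x \<in> V" "y \<in> V"
  shows "graph_components V (insert {x, y} S) =
    insert (comp_of S x \<union> comp_of S y) (graph_components V S - {comp_of S x, comp_of S y})"
proof -
  have T: "e \<subseteq> V" if "e \<in> insert {x, y} S" for e using that S xy by auto
  have key: "comp_of S u = comp_of S x \<or> comp_of S u = comp_of S y
      \<longleftrightarrow> u \<in> comp_of S x \<union> comp_of S y" for u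
    by (metis UnE UnI1 UnI2 comp_of_eq comp_of_self)
  have T_eq: "graph_components V (insert {x, y} S) = comp_of (insert {x, y} S) ` V"
    by (rule graph_components_eq) (rule T)
  have S_eq: "graph_components V S = comp_of S ` V"
    by (rule graph_components_eq) (rule S)
  show ?thesis
    unfolding T_eq S_eq
  proof (intro equalityI subsetI)
    fix C assume "C \<in> comp_of (insert {x, y} S) ` V"
    then obtain u where u: "u \<in> V" "C = comp_of (insert {x, y} S) u" by auto
    show "C \<in> insert (comp_of S x \<union> comp_of S y) (comp_of S ` V - {comp_of S x, comp_of S y})"
    proof (cases "u \<in> comp_of S x \<union> comp_of S y")
      case True
      then have "C = comp_of S x \<union> comp_of S y" using u by (simp add: comp_of_insert)
      then show ?thesis by simp
    next
      case False
      then have "C = comp_of S u" using u by (simp add: comp_of_insert)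
      then show ?thesis using u(1) False key[of u] by simp
    qed
  next
    fix C assume C: "C \<in> insert (comp_of S x \<union> comp_of S y) (comp_of S ` V - {comp_of S x, comp_of S y})"
    show "C \<in> comp_of (insert {x, y} S) ` V"
    proof (cases "C = comp_of S x \<union> comp_of S y")
      case True
      then have "C = comp_of (insert {x, y} S) x" by (simp add: comp_of_insert comp_of_self)
      then show ?thesis using xy by blast
    next
      case False
      then obtain u where u: "u \<in> V" "C = comp_of S u" "C \<noteq> comp_of S x" "C \<noteq> comp_of S y"
        using C by auto
      then have "C = comp_of (insert {x, y} S) u" using key[of u] by (simp add: comp_of_insert)
      then show ?thesis using u by blast
    qed
  qed
qed

text \<open>Merging components of weights \<open>a\<close> and \<open>b\<close> replaces
  \<open>(1 + a) * (1 + b)\<close> by \<open>1 + a * b\<close>, and the quotient of the two is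
  \<open>1 + (a + b) / (1 + a * b)\<close>.\<close>

definition merge_cost :: "('v \<Rightarrow> real) \<Rightarrow> 'v set set \<Rightarrow> 'v \<Rightarrow> 'v \<Rightarrow> real" where
  "merge_cost lam S x y =
    (if y \<in> comp_of S x then 0
     else (prod lam (comp_of S x) + prod lam (comp_of S y))
        / (1 + prod lam (comp_of S x) * prod lam (comp_of S y)))"

lemma merge_cost_commute: "merge_cost lam S x y = merge_cost lam S y x"
  using comp_of_sym[of x S y] comp_of_sym[of y S x] by (auto simp: merge_cost_def ac_simps)

lemma cluster_product_insert:
  assumes S: "\<And>e. e \<in> S \<Longrightarrow> e \<subseteq> V" and "finite V" and xy: "x \<in> V" "y \<in> V"
    and lam: "\<And>v. v \<in> V \<Longrightarrow> 0 < lam v"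
  shows "(\<Prod>C\<in>graph_components V S. 1 + prod lam C) =
    (1 + merge_cost lam S x y) * (\<Prod>C\<in>graph_components V (insert {x, y} S). 1 + prod lam C)"
proof -
  let ?g = "\<lambda>C. 1 + prod lam C" and ?A = "comp_of S x" and ?B = "comp_of S y"
  let ?R = "graph_components V S - {?A, ?B}"
  have AB: "?A \<in> graph_components V S" "?B \<in> graph_components V S"
    using xy by (auto simp: graph_components_eq[OF S])
  have fin: "finite (graph_components V S)"
    using \<open>finite V\<close> by (simp add: graph_components_eq[OF S])
  show ?thesis
  proof (cases "y \<in> ?A")
    case True
    then have "?B = ?A" by (rule comp_of_eq)
    then have "insert (?A \<union> ?B) ?R = graph_components V S" using AB by auto
    then show ?thesis using True
      by (simp add: graph_components_insert[OF S xy] merge_cost_def)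
  next
    case False
    have ne: "?A \<noteq> ?B" using False comp_of_self[of y S] by auto
    have disj: "?A \<inter> ?B = {}" by (rule comp_of_disjoint[OF False])
    have sub: "?A \<subseteq> V" "?B \<subseteq> V" using comp_of_subset[of S V] S xy by auto
    have finAB: "finite ?A" "finite ?B" using sub \<open>finite V\<close> finite_subset by auto
    \<comment> \<open>The merged set is not among the remaining components, so it contributes a
      factor of its own.\<close>
    have notin: "?A \<union> ?B \<notin> ?R"
    proof
      assume "?A \<union> ?B \<in> ?R"
      then obtain u where u: "?A \<union> ?B = comp_of S u" by (auto simp: graph_components_eq[OF S])
      then have "x \<in> comp_of S u" "y \<in> comp_of S u" using comp_of_self by fast+
      then have "?A = ?B" using comp_of_eq by metis
      then show False using ne by simp
    qed
    have "(\<Prod>C\<in>graph_components V S. ?g C) = ?g ?A * ?g ?B * prod ?g ?R"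
    proof -
      have "(\<Prod>C\<in>graph_components V S. ?g C) = ?g ?A * prod ?g (graph_components V S - {?A})"
        by (rule prod.remove[OF fin AB(1)])
      also have "prod ?g (graph_components V S - {?A})
          = ?g ?B * prod ?g (graph_components V S - {?A} - {?B})"
        using AB fin ne by (intro prod.remove) auto
      also have "graph_components V S - {?A} - {?B} = ?R" by auto
      finally show ?thesis by (simp only: mult.assoc)
    qed
    moreover have "(\<Prod>C\<in>graph_components V (insert {x, y} S). ?g C)
        = (1 + prod lam ?A * prod lam ?B) * prod ?g ?R"
    proof -
      have "(\<Prod>C\<in>graph_components V (insert {x, y} S). ?g C) = prod ?g (insert (?A \<union> ?B) ?R)"
        by (simp add: graph_components_insert[OF S xy])
      also have "\<dots> = ?g (?A \<union> ?B) * prod ?g ?R"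
        using fin notin by (intro prod.insert) auto
      also have "prod lam (?A \<union> ?B) = prod lam ?A * prod lam ?B"
        by (rule prod.union_disjoint[OF finAB disj])
      finally show ?thesis .
    qed
    moreover have "?g ?A * ?g ?B = (1 + merge_cost lam S x y) * (1 + prod lam ?A * prod lam ?B)"
    proof -
      have "0 < prod lam ?A" "0 < prod lam ?B"
        using sub lam by (auto intro!: prod_pos)
      then have "0 < 1 + prod lam ?A * prod lam ?B" by (intro add_pos_pos mult_pos_pos) auto
      then have "merge_cost lam S x y * (1 + prod lam ?A * prod lam ?B) = prod lam ?A + prod lam ?B"
        using False by (simp add: merge_cost_def)
      then show ?thesis unfolding distrib_right[of 1 "merge_cost lam S x y"] by (simp add: algebra_simps)
    qed
    ultimately show ?thesis by (simp only: mult.assoc)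
  qed
qed

section \<open>Change of the merge cost under one more edge\<close>

lemma merge_fraction_diff:
  fixes a a' c :: real
  assumes "0 \<le> a'" "a' \<le> a" "a \<le> 1" "0 \<le> c" "c \<le> 1"
  shows "(a' + c) / (1 + a' * c) \<le> (a + c) / (1 + a * c)"
    and "(a + c) / (1 + a * c) - (a' + c) / (1 + a' * c) \<le> a - a'"
proof -
  let ?d = "(1 + a * c) * (1 + a' * c)"
  have p: "1 \<le> 1 + a * c" "1 \<le> 1 + a' * c" using assms by auto
  then have d: "1 \<le> ?d" using mult_mono[of 1 "1 + a * c" 1 "1 + a' * c"] by simp
  have ne: "1 + a * c \<noteq> 0" "1 + a' * c \<noteq> 0" using p by linarith+
  \<comment> \<open>The fraction is the addition law of tanh. Its derivative in \<open>a\<close> is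
    \<open>(1 - c * c) / (1 + a * c) ^ 2\<close>, which lies between 0 and 1; this identity is the
    finite form.\<close>
  have eq: "(a + c) / (1 + a * c) - (a' + c) / (1 + a' * c) = (a - a') * (1 - c * c) / ?d"
    by (subst diff_frac_eq[OF ne]) (simp add: algebra_simps)
  have c: "0 \<le> 1 - c * c" "1 - c * c \<le> 1"
    using assms mult_mono[of c 1 c 1] by auto
  have "0 \<le> (a - a') * (1 - c * c) / ?d" using assms c d by (intro divide_nonneg_nonneg mult_nonneg_nonneg) auto
  then show "(a' + c) / (1 + a' * c) \<le> (a + c) / (1 + a * c)" using eq by simp
  have "(a - a') * (1 - c * c) \<le> (a - a') * 1" using assms c by (intro mult_left_mono) auto
  also have "\<dots> \<le> (a - a') * ?d" using assms d by (intro mult_left_mono) auto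
  finally have "(a - a') * (1 - c * c) / ?d \<le> a - a'" using d by (subst pos_divide_le_eq) auto
  then show "(a + c) / (1 + a * c) - (a' + c) / (1 + a' * c) \<le> a - a'" using eq by simp
qed

lemma merge_fraction_bounds:
  fixes a b :: real
  assumes "0 \<le> a" "a \<le> 1" "0 \<le> b" "b \<le> 1"
  shows "0 \<le> (a + b) / (1 + a * b)" "(a + b) / (1 + a * b) \<le> 1" "(a + b) / (1 + a * b) \<le> a + b"
proof -
  have p: "1 \<le> 1 + a * b" using assms by simp
  show "0 \<le> (a + b) / (1 + a * b)" using assms p by (intro divide_nonneg_nonneg) auto
  have "0 \<le> (1 - a) * (1 - b)" using assms by (intro mult_nonneg_nonneg) auto
  then show "(a + b) / (1 + a * b) \<le> 1" using p by (simp add: algebra_simps)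
  have "(a + b) * 1 \<le> (a + b) * (1 + a * b)" using assms p by (intro mult_left_mono) auto
  then show "(a + b) / (1 + a * b) \<le> a + b" using p by (subst pos_divide_le_eq) auto
qed

definition edge_boundary :: "'v set set \<Rightarrow> 'v set \<Rightarrow> 'v set set" where
  "edge_boundary E A = {f \<in> E. f \<inter> A \<noteq> {} \<and> \<not> f \<subseteq> A}"

lemma edge_boundary_pair:
  "{x, y} \<in> E \<Longrightarrow> {x, y} \<in> edge_boundary E A \<longleftrightarrow> (x \<in> A) \<noteq> (y \<in> A)"
  by (auto simp: edge_boundary_def)

text \<open>Let \<open>A\<close> and \<open>B\<close> be the components of \<open>u\<close> and
  \<open>v\<close>, of weights \<open>a\<close> and \<open>b\<close>. If \<open>A = B\<close>
  nothing changes; otherwise the cost changes only if an endpoint of \<open>{x, y}\<close> lies in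
  \<open>A \<union> B\<close>. If the edge runs from \<open>A\<close> to \<open>B\<close>, the cost
  falls from at most \<open>a + b\<close> to 0. If it runs from \<open>A\<close> to a third
  component, \<open>a\<close> is replaced by \<open>a * b\<close>, and the cost falls by at most
  \<open>a - a * b\<close>.\<close>

lemma merge_cost_insert_edge:
  assumes lam: "prod lam (comp_of S u) \<in> {0..1}" "prod lam (comp_of S v) \<in> {0..1}"
      "prod lam (comp_of S x) \<in> {0..1}" "prod lam (comp_of S y) \<in> {0..1}"
    and disj: "v \<notin> comp_of S u \<Longrightarrow> prod lam (comp_of S u \<union> comp_of S v) = prod lam (comp_of S u) * prod lam (comp_of S v)"
  shows "merge_cost lam (insert {u, v} S) x y \<le> merge_cost lam S x y"
      (is "?new \<le> ?old")
    and "merge_cost lam S x y - merge_cost lam (insert {u, v} S) x y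
      \<le> (if (x \<in> comp_of S u) \<noteq> (y \<in> comp_of S u) then prod lam (comp_of S u) else 0)
        + (if (x \<in> comp_of S v) \<noteq> (y \<in> comp_of S v) then prod lam (comp_of S v) else 0)"
proof -
  let ?P = "\<lambda>u v x y. merge_cost lam (insert {u, v} S) x y \<le> merge_cost lam S x y \<and>
    merge_cost lam S x y - merge_cost lam (insert {u, v} S) x y
      \<le> (if (x \<in> comp_of S u) \<noteq> (y \<in> comp_of S u) then prod lam (comp_of S u) else 0)
        + (if (x \<in> comp_of S v) \<noteq> (y \<in> comp_of S v) then prod lam (comp_of S v) else 0)"
  have nn: "0 \<le> (if b then prod lam (comp_of S u) else 0)" "0 \<le> (if b then prod lam (comp_of S v) else 0)" for b
    using lam by auto
  \<comment> \<open>The case in which \<open>x\<close> lies in the component of \<open>u\<close>. It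
    is quantified over all four vertices so that swapping \<open>u\<close> with \<open>v\<close> and
    \<open>x\<close> with \<open>y\<close> gives the remaining cases.\<close>
  have touching: "?P u v x y" if x: "x \<in> comp_of S u" and v: "v \<notin> comp_of S u"
    and un: "prod lam (comp_of S u \<union> comp_of S v) = prod lam (comp_of S u) * prod lam (comp_of S v)"
    and lam: "prod lam (comp_of S u) \<in> {0..1}" "prod lam (comp_of S v) \<in> {0..1}"
      "prod lam (comp_of S y) \<in> {0..1}"
    for u v x y
  proof -
    let ?A = "comp_of S u" and ?B = "comp_of S v"
    have nn: "0 \<le> (if b then prod lam ?A else 0)" "0 \<le> (if b then prod lam ?B else 0)" for b
      using lam by auto
    have Sx: "comp_of S x = ?A" by (rule comp_of_eq[OF x])
    have Tx: "comp_of (insert {u, v} S) x = ?A \<union> ?B" using x by (simp add: comp_of_insert)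
    have dj: "?A \<inter> ?B = {}" by (rule comp_of_disjoint[OF v])
    consider "y \<in> ?A" | "y \<in> ?B" "y \<notin> ?A" | "y \<notin> ?A" "y \<notin> ?B" by blast
    then show ?thesis
    proof cases
      case 1
      then have "merge_cost lam S x y = 0" "merge_cost lam (insert {u, v} S) x y = 0"
        by (simp_all add: merge_cost_def Sx Tx)
      then show ?thesis using add_nonneg_nonneg[OF nn] by simp
    next
      case 2
      have Sy: "comp_of S y = ?B" by (rule comp_of_eq[OF 2(1)])
      have new: "merge_cost lam (insert {u, v} S) x y = 0" using 2 by (simp add: merge_cost_def Tx)
      have old: "merge_cost lam S x y = (prod lam ?A + prod lam ?B) / (1 + prod lam ?A * prod lam ?B)"
        using 2 by (simp add: merge_cost_def Sx Sy)
      have "x \<notin> ?B" using x dj by auto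
      then show ?thesis
        using merge_fraction_bounds[of "prod lam ?A" "prod lam ?B"] lam x 2
        unfolding new old by simp
    next
      case 3
      have Ty: "comp_of (insert {u, v} S) y = comp_of S y" using 3 by (simp add: comp_of_insert)
      let ?a = "prod lam ?A" and ?b = "prod lam ?B" and ?c = "prod lam (comp_of S y)"
      have new: "merge_cost lam (insert {u, v} S) x y = (?a * ?b + ?c) / (1 + ?a * ?b * ?c)"
        using 3 by (simp add: merge_cost_def Tx Ty un)
      have old: "merge_cost lam S x y = (?a + ?c) / (1 + ?a * ?c)"
        using 3 by (simp add: merge_cost_def Sx)
      have ab: "0 \<le> ?a * ?b" "?a * ?b \<le> ?a"
        using lam by (auto simp: mult_left_le)
      have "merge_cost lam S x y - merge_cost lam (insert {u, v} S) x y \<le> ?a - ?a * ?b"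
        "merge_cost lam (insert {u, v} S) x y \<le> merge_cost lam S x y"
        using merge_fraction_diff[of "?a * ?b" ?a ?c] lam ab
        unfolding new old by simp_all
      moreover have "(if (x \<in> ?A) \<noteq> (y \<in> ?A) then ?a else 0) = ?a" using x 3 by simp
      ultimately show ?thesis using ab nn(2)[of "(x \<in> ?B) \<noteq> (y \<in> ?B)"] by linarith
    qed
  qed
  have "?P u v x y"
  proof (cases "v \<in> comp_of S u")
    case True
    then have uv: "comp_of S v = comp_of S u" by (rule comp_of_eq)
    have "comp_of (insert {u, v} S) z = comp_of S z" for z
      using comp_of_eq[of z S u] by (simp add: comp_of_insert uv)
    then have "merge_cost lam (insert {u, v} S) x y = merge_cost lam S x y"
      by (simp add: merge_cost_def)
    then show ?thesis using add_nonneg_nonneg[OF nn] by simp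
  next
    case False
    have False': "u \<notin> comp_of S v" using False comp_of_sym[of u S v] by blast
    have un: "prod lam (comp_of S u \<union> comp_of S v) = prod lam (comp_of S u) * prod lam (comp_of S v)"
      using disj[OF False] .
    have un': "prod lam (comp_of S v \<union> comp_of S u) = prod lam (comp_of S v) * prod lam (comp_of S u)"
      using un by (simp add: Un_commute mult.commute)
    have symm: "?P u v y x \<Longrightarrow> ?P u v x y" "?P v u x y \<Longrightarrow> ?P u v x y" "?P v u y x \<Longrightarrow> ?P u v x y"
      using merge_cost_commute[of lam S x y] merge_cost_commute[of lam "insert {u, v} S" x y]
        insert_commute[of u v "{}"] by (auto simp: eq_commute)
    consider "x \<in> comp_of S u" | "x \<in> comp_of S v" | "y \<in> comp_of S u" | "y \<in> comp_of S v"
      | "x \<notin> comp_of S u \<union> comp_of S v" "y \<notin> comp_of S u \<union> comp_of S v" by blast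
    then show ?thesis
    proof cases
      case 5
      then have "comp_of (insert {u, v} S) x = comp_of S x" "comp_of (insert {u, v} S) y = comp_of S y"
        by (simp_all add: comp_of_insert)
      then have "merge_cost lam (insert {u, v} S) x y = merge_cost lam S x y"
        by (simp add: merge_cost_def)
      then show ?thesis using add_nonneg_nonneg[OF nn] by simp
    next
      case 1 then show ?thesis by (intro touching[OF _ False un] lam)
    next
      case 2 then show ?thesis by (intro symm(2) touching[OF _ False' un'] lam)
    next
      case 3 then show ?thesis by (intro symm(1) touching[OF _ False un] lam)
    next
      case 4 then show ?thesis by (intro symm(3) touching[OF _ False' un'] lam)
    qed
  qed
  then show "?new \<le> ?old" "merge_cost lam S x y - merge_cost lam (insert {u, v} S) x y
      \<le> (if (x \<in> comp_of S u) \<noteq> (y \<in> comp_of S u) then prod lam (comp_of S u) else 0)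
        + (if (x \<in> comp_of S v) \<noteq> (y \<in> comp_of S v) then prod lam (comp_of S v) else 0)"
    by blast+
qed

text \<open>Among the edges counted, take \<open>g\<close> whose component \<open>C\<close> of \<open>u\<close> is largest. Every other edge has
  its far endpoint in \<open>C - {u}\<close>, for otherwise its component of \<open>u\<close> would contain \<open>C\<close> and the far
  endpoint of \<open>g\<close>; and distinct edges have distinct far endpoints.\<close>

lemma card_separating_edges_le:
  fixes Y :: "'v set set"
  assumes Y: "\<And>e. e \<in> Y \<Longrightarrow> e \<subseteq> V \<and> card e = 2" and "finite V" "u \<in> V"
  shows "card {f \<in> Y. f \<in> edge_boundary Y (comp_of (Y - {f}) u) \<and> card (comp_of (Y - {f}) u) \<le> s} \<le> s"
    (is "card ?F \<le> s")
proof (cases "?F = {}")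
  case False
  define F where "F = ?F"
  define S where "S f = comp_of (Y - {f}) u" for f
  have finS: "finite (S f)" for f
    unfolding S_def using comp_of_subset[of "Y - {f}" V u] Y assms(2,3) by (auto intro: finite_subset)
  have uS: "u \<in> S f" for f by (simp add: S_def comp_of_self)
  have F_ne: "F \<noteq> {}" using False by (simp add: F_def)
  have FY: "f \<in> Y" and F_bd: "f \<in> edge_boundary Y (S f)" and F_s: "card (S f) \<le> s"
    if "f \<in> F" for f using that by (auto simp: F_def S_def)
  have ex: "\<forall>f\<in>F. \<exists>x y. f = {x, y} \<and> x \<in> S f \<and> y \<notin> S f"
  proof
    fix f assume f: "f \<in> F"
    have "card f = 2" using Y FY[OF f] by blast
    then obtain a b where "f = {a, b}" by (auto simp: card_2_iff)
    then show "\<exists>x y. f = {x, y} \<and> x \<in> S f \<and> y \<notin> S f"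
      using F_bd[OF f] by (auto simp: edge_boundary_def insert_commute)
  qed
  obtain near where near: "\<forall>f\<in>F. \<exists>y. f = {near f, y} \<and> near f \<in> S f \<and> y \<notin> S f"
    using bchoice[OF ex] by blast
  obtain far where far: "\<forall>f\<in>F. f = {near f, far f} \<and> near f \<in> S f \<and> far f \<notin> S f"
    using bchoice[OF near] by blast
  have nf: "f = {near f, far f}" "near f \<in> S f" "far f \<notin> S f" if "f \<in> F" for f
    using far that by blast+
  have closed: "w \<in> S f" if "v \<in> S f" "{v, w} \<in> Y" "{v, w} \<noteq> f" for f v w
    using that unfolding S_def by (intro comp_of_step[of v _ u w]) auto
  \<comment> \<open>\<open>f\<close> is the only edge of \<open>Y\<close> that leaves
    \<open>S f\<close>. A path from \<open>u\<close> inside \<open>S g\<close> cannot use it when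
    the far endpoint of \<open>f\<close> lies outside \<open>S g\<close>, so it stays in
    \<open>S f\<close>.\<close>
  have nest: "S g \<subseteq> S f" if f: "f \<in> F" and y: "far f \<notin> S g" for f g
  proof -
    have "S g \<subseteq> S g \<inter> S f"
      unfolding S_def[of g]
    proof (rule comp_of_least)
      fix v w assume v: "v \<in> comp_of (Y - {g}) u \<inter> S f" and vw: "{v, w} \<in> Y - {g}"
      then have w: "w \<in> comp_of (Y - {g}) u" using comp_of_step by fast
      have "{v, w} \<noteq> f"
      proof
        assume "{v, w} = f"
        then have "v = near f \<and> w = far f \<or> v = far f \<and> w = near f"
          using nf(1)[OF f] by (metis doubleton_eq_iff)
        then show False using v w y nf(3)[OF f] by (auto simp: S_def)
      qed
      then show "w \<in> comp_of (Y - {g}) u \<inter> S f" using closed[of v f w] v vw w by auto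
    qed (use uS in \<open>auto simp: comp_of_self\<close>)
    then show ?thesis by blast
  qed
  \<comment> \<open>Equal far endpoints would put \<open>near g\<close> into \<open>S f\<close>, and
    then, across \<open>g\<close>, also \<open>far g = far f\<close>.\<close>
  have inj: "inj_on far F"
  proof (rule inj_onI, rule ccontr)
    fix f g assume fg: "f \<in> F" "g \<in> F" "far f = far g" "f \<noteq> g"
    then have "S g \<subseteq> S f" using nest[OF fg(1), of g] nf(3)[OF fg(2)] by simp
    then have "near g \<in> S f" using nf(2)[OF fg(2)] by blast
    then have "far g \<in> S f"
      using closed[of "near g" f "far g"] nf(1)[OF fg(2)] fg(4) FY[OF fg(2)] by auto
    then show False using nf(3)[OF fg(1)] fg(3) by simp
  qed
  have "Y \<subseteq> Pow V" using Y by auto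
  then have "finite Y" using assms(2) by (auto intro: finite_subset)
  then have finF: "finite F" by (simp add: F_def)
  obtain g where g: "g \<in> F" and max: "\<And>f. f \<in> F \<Longrightarrow> card (S f) \<le> card (S g)"
  proof -
    have "Max ((\<lambda>f. card (S f)) ` F) \<in> (\<lambda>f. card (S f)) ` F"
      using finF F_ne by (intro Max_in) auto
    then obtain g where "g \<in> F" "card (S g) = Max ((\<lambda>f. card (S f)) ` F)" by auto
    then show ?thesis using that[of g] finF by simp
  qed
  have "far f \<in> S g - {u}" if f: "f \<in> F - {g}" for f
  proof (rule ccontr)
    assume "far f \<notin> S g - {u}"
    then have "far f \<notin> S g" using nf(3)[of f] uS[of f] f by auto
    then have sub: "S g \<subseteq> S f" using nest f by auto
    then have "near g \<in> S f" using nf(2)[OF g] by auto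
    then have "far g \<in> S f" using closed[of "near g" f "far g"] nf(1)[OF g] f FY[OF g] by auto
    then have "S g \<subset> S f" using sub nf(3)[OF g] by auto
    then have "card (S g) < card (S f)" by (rule psubset_card_mono[OF finS])
    then show False using max[of f] f by simp
  qed
  then have "far ` (F - {g}) \<subseteq> S g - {u}" by blast
  then have "card (far ` (F - {g})) \<le> card (S g - {u})" using finS by (intro card_mono) auto
  also have "card (far ` (F - {g})) = card (F - {g})"
    by (rule card_image) (rule inj_on_subset[OF inj], blast)
  \<comment> \<open>Leaving out \<open>u\<close> saves one, which pays for \<open>g\<close>
    itself.\<close>
  also have "card (S g - {u}) = card (S g) - 1" using uS finS by simp
  finally have "card (F - {g}) \<le> card (S g) - 1" .
  moreover have "card F = Suc (card (F - {g}))" by (rule card.remove[OF finF g])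
  moreover have "0 < card (S g)" using uS[of g] finS[of g] by (auto simp: card_gt_0_iff)
  moreover have "card (S g) \<le> s" by (rule F_s[OF g])
  ultimately show ?thesis unfolding F_def[symmetric] by linarith
next
  case True
  then show ?thesis by (simp only: card.empty)
qed

section \<open>Geometric sums and affine recursions\<close>

lemma sum_power_rank_le:
  fixes L :: real
  assumes "finite F" and L: "0 \<le> L" "L < 1" and h: "\<And>s. card {f \<in> F. h f \<le> s} \<le> s"
  shows "(\<Sum>f\<in>F. L ^ h f) \<le> 1 / (1 - L)"
proof -
  \<comment> \<open>Elements are added in increasing order of \<open>h\<close>. When the new one
    brings the set to size \<open>j\<close>, all \<open>j\<close> elements have \<open>h\<close> at
    most its own value, so that value is at least \<open>j\<close>: the sorted exponents dominate 1,
    2, 3 and so on.\<close>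
  have "(\<Sum>f\<in>F. L ^ h f) \<le> (\<Sum>i<card F. L ^ Suc i)"
    using assms(1) h
  proof (induction F rule: finite_ranking_induct[where f = h])
    case (insert x S)
    show ?case
    proof (cases "x \<in> S")
      case True
      then show ?thesis using insert.IH insert.prems by (simp add: insert_absorb)
    next
      case False
      have "card {f \<in> S. h f \<le> s} \<le> card {f \<in> insert x S. h f \<le> s}" for s
        using insert.hyps(1) by (intro card_mono) auto
      then have IH: "(\<Sum>f\<in>S. L ^ h f) \<le> (\<Sum>i<card S. L ^ Suc i)"
        using insert.IH insert.prems order_trans by blast
      have "{f \<in> insert x S. h f \<le> h x} = insert x S" using insert.hyps(2) by auto
      then have "card (insert x S) \<le> h x" using insert.prems[of "h x"] by simp
      then have "L ^ h x \<le> L ^ Suc (card S)"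
        using False insert.hyps(1) L by (intro power_decreasing) auto
      then show ?thesis using IH False insert.hyps(1) by simp
    qed
  qed simp
  also have "\<dots> \<le> (\<Sum>i<card F. L ^ i)"
    using L by (intro sum_mono power_decreasing) auto
  also have "\<dots> = (1 - L ^ card F) / (1 - L)"
    using L by (simp add: sum_gp_strict)
  also have "\<dots> \<le> 1 / (1 - L)"
    using L by (intro divide_right_mono) auto
  finally show ?thesis .
qed

lemma nat_mult_power_le:
  fixes L :: real
  assumes "0 \<le> L" "L < 1"
  shows "real s * L ^ s \<le> 1 / (1 - L)"
proof -
  have "real s * L ^ s = (\<Sum>i<s. L ^ s)" by simp
  also have "\<dots> \<le> (\<Sum>i<s. L ^ i)"
    using assms by (intro sum_mono power_decreasing) auto
  also have "\<dots> = (1 - L ^ s) / (1 - L)"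
    using assms by (simp add: sum_gp_strict)
  also have "\<dots> \<le> 1 / (1 - L)"
    using assms by (intro divide_right_mono) auto
  finally show ?thesis .
qed

text \<open>\<open>\<beta> / (1 - \<alpha>)\<close> is the fixed point of the recursion, and the
  excess over it contracts by \<open>\<alpha>\<close> per step.\<close>

lemma affine_recursion_le:
  fixes a :: "nat \<Rightarrow> real"
  assumes step: "\<And>t. a (Suc t) \<le> \<alpha> * a t + \<beta>" and \<alpha>: "0 \<le> \<alpha>" "\<alpha> < 1"
    and \<beta>: "0 \<le> \<beta>"
  shows "a t \<le> \<alpha> ^ t * a 0 + \<beta> / (1 - \<alpha>)"
proof (induction t)
  case 0
  then show ?case using \<alpha> \<beta> by simp
next
  case (Suc t)
  have "a (Suc t) \<le> \<alpha> * (\<alpha> ^ t * a 0 + \<beta> / (1 - \<alpha>)) + \<beta>"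
    using step[of t] mult_left_mono[OF Suc \<alpha>(1)] by linarith
  also have "\<dots> = \<alpha> ^ Suc t * a 0 + \<beta> / (1 - \<alpha>)"
    using \<alpha> by (simp add: field_simps)
  finally show ?case .
qed

lemma one_minus_inverse_power_le:
  fixes x :: real
  assumes "1 \<le> x"
  shows "(1 - 1 / x) ^ k \<le> exp (- (real k / x))"
proof -
  have "1 - 1 / x \<le> exp (- (1 / x))" using exp_ge_add_one_self[of "- (1 / x)"] by simp
  then have "(1 - 1 / x) ^ k \<le> exp (- (1 / x)) ^ k" using assms by (intro power_mono) auto
  also have "\<dots> = exp (real k * - (1 / x))" by (rule exp_of_nat_mult[symmetric])
  finally show ?thesis by simp
qed

section \<open>The random cluster model\<close>

text \<open>\<open>\<theta>\<close> and \<open>L\<close> are bounds that will be taken as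
  \<open>1 - pmin\<close> and \<open>lmax\<close>.\<close>

locale random_cluster_model =
  fixes V :: "'v set" and E :: "'v set set" and p :: "'v set \<Rightarrow> real" and lam :: "'v \<Rightarrow> real"
    and \<theta> L :: real
  assumes graph: "simple_graph V E" and edges_nonempty: "E \<noteq> {}"
    and p_range: "\<And>e. e \<in> E \<Longrightarrow> 0 < p e \<and> p e < 1"
    and p_ge: "\<And>e. e \<in> E \<Longrightarrow> 1 - p e \<le> \<theta>"
    and lam_pos: "\<And>v. v \<in> V \<Longrightarrow> 0 < lam v"
    and lam_le: "\<And>v. v \<in> V \<Longrightarrow> lam v \<le> L"
    and L_less_1: "L < 1"
begin

lemma finite_V: "finite V"
  using graph by (simp add: simple_graph_def)

lemma finite_E: "finite E"
  by (rule finite_edges[OF graph])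

lemma edge_subset: "S \<subseteq> E \<Longrightarrow> e \<in> S \<Longrightarrow> e \<subseteq> V"
  using graph by (auto simp: simple_graph_def)

lemma edgeE:
  assumes "e \<in> E"
  obtains x y where "e = {x, y}" "x \<in> V" "y \<in> V"
proof -
  have "card e = 2" "e \<subseteq> V" using graph assms by (auto simp: simple_graph_def)
  then show thesis using that by (auto simp: card_2_iff)
qed

lemma V_ne: "V \<noteq> {}"
proof -
  obtain e where "e \<in> E" using edges_nonempty by blast
  then show ?thesis by (rule edgeE) auto
qed

lemma L_pos: "0 < L"
proof -
  obtain v where "v \<in> V" using V_ne by blast
  then show ?thesis using lam_pos[of v] lam_le[of v] by linarith
qed

lemma \<theta>_pos: "0 < \<theta>"
proof -
  obtain e where "e \<in> E" using edges_nonempty by blast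
  then show ?thesis using p_range[of e] p_ge[of e] by linarith
qed

lemma comp_subset: "S \<subseteq> E \<Longrightarrow> u \<in> V \<Longrightarrow> comp_of S u \<subseteq> V"
  by (rule comp_of_subset) (auto dest: edge_subset)

lemma finite_comp: "S \<subseteq> E \<Longrightarrow> u \<in> V \<Longrightarrow> finite (comp_of S u)"
  by (rule finite_subset[OF comp_subset finite_V])

lemma prod_lam_pos: "C \<subseteq> V \<Longrightarrow> 0 < prod lam C"
  by (rule prod_pos) (auto intro: lam_pos)

lemma prod_lam_le:
  assumes "C \<subseteq> V"
  shows "prod lam C \<le> L ^ card C"
proof -
  have "prod lam C \<le> (\<Prod>_\<in>C. L)"
    by (rule prod_mono) (use assms lam_le lam_pos in \<open>auto intro: less_imp_le\<close>)
  then show ?thesis by simp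
qed

lemma prod_lam_le_1:
  assumes "C \<subseteq> V"
  shows "prod lam C \<le> 1"
  using prod_lam_le[OF assms] L_pos L_less_1 power_le_one[of L "card C"] by linarith

section \<open>Edge costs and update probabilities\<close>

definition cluster_weight :: "'v set set \<Rightarrow> real" where
  "cluster_weight S = (\<Prod>C\<in>graph_components V S. 1 + prod lam C)"

text \<open>Written as a ratio so that no endpoints of \<open>e\<close> have to be chosen. On a pair
  of vertices it is the merge cost; for \<open>e \<in> S \<subseteq> E\<close> it is 0.\<close>

definition edge_cost :: "'v set set \<Rightarrow> 'v set \<Rightarrow> real" where
  "edge_cost S e = cluster_weight S / cluster_weight (insert e S) - 1"

lemma cluster_weight_pos:
  assumes "S \<subseteq> E"
  shows "0 < cluster_weight S"
  unfolding cluster_weight_def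
proof (rule prod_pos)
  fix C assume "C \<in> graph_components V S"
  then have "C \<subseteq> V" by (auto simp: graph_components_def quotient_def connected_in_def)
  then show "0 < 1 + prod lam C" using prod_lam_pos[of C] by simp
qed

lemma edge_cost_pair:
  assumes "S \<subseteq> E" "{x, y} \<in> E"
  shows "edge_cost S {x, y} = merge_cost lam S x y"
proof -
  have xy: "x \<in> V" "y \<in> V" using edge_subset[OF order_refl assms(2)] by auto
  have "cluster_weight S = (1 + merge_cost lam S x y) * cluster_weight (insert {x, y} S)"
    unfolding cluster_weight_def
    by (rule cluster_product_insert) (use edge_subset assms(1) finite_V xy lam_pos in auto)
  moreover have "0 < cluster_weight (insert {x, y} S)"
    using assms by (intro cluster_weight_pos) auto
  ultimately show ?thesis by (simp add: edge_cost_def)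
qed

lemma edge_cost_bounds:
  assumes "S \<subseteq> E" "e \<in> E"
  shows "0 \<le> edge_cost S e" "edge_cost S e \<le> 1"
proof -
  obtain x y where e: "e = {x, y}" and xy: "x \<in> V" "y \<in> V" using edgeE[OF assms(2)] .
  have "0 \<le> prod lam (comp_of S x)" "prod lam (comp_of S x) \<le> 1"
    "0 \<le> prod lam (comp_of S y)" "prod lam (comp_of S y) \<le> 1"
    using comp_subset[OF assms(1)] xy prod_lam_pos prod_lam_le_1 by (auto intro: less_imp_le)
  note * = merge_fraction_bounds[OF this]
  show "0 \<le> edge_cost S e" "edge_cost S e \<le> 1"
    using * edge_cost_pair[OF assms(1), of x y] assms(2)
    by (auto simp: e merge_cost_def)
qed

lemma edge_cost_insert:
  assumes S: "S \<subseteq> E" and f: "f \<in> E" and uv: "{u, v} \<in> E"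
  shows "edge_cost (insert {u, v} S) f \<le> edge_cost S f"
    and "edge_cost S f - edge_cost (insert {u, v} S) f
      \<le> (if f \<in> edge_boundary E (comp_of S u) then prod lam (comp_of S u) else 0)
        + (if f \<in> edge_boundary E (comp_of S v) then prod lam (comp_of S v) else 0)"
proof -
  obtain x y where fe: "f = {x, y}" and xy: "x \<in> V" "y \<in> V" using edgeE[OF f] .
  have uvV: "u \<in> V" "v \<in> V" using edge_subset[OF order_refl uv] by auto
  have T: "insert {u, v} S \<subseteq> E" using S uv by simp
  have disj: "prod lam (comp_of S u \<union> comp_of S v) = prod lam (comp_of S u) * prod lam (comp_of S v)"
    if "v \<notin> comp_of S u"
    using finite_comp[OF S] uvV comp_of_disjoint[OF that] by (intro prod.union_disjoint) auto
  have cw: "prod lam (comp_of S z) \<in> {0..1}" if "z \<in> V" for z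
    using prod_lam_pos prod_lam_le_1 comp_subset[OF S that] by (auto intro: less_imp_le)
  note * = merge_cost_insert_edge[where u = u and v = v and x = x and y = y and lam = lam and S = S, OF cw[OF uvV(1)] cw[OF uvV(2)] cw[OF xy(1)] cw[OF xy(2)] disj]
  show "edge_cost (insert {u, v} S) f \<le> edge_cost S f"
    using *(1) edge_cost_pair[OF S] edge_cost_pair[OF T] f by (simp add: fe)
  show "edge_cost S f - edge_cost (insert {u, v} S) f
      \<le> (if f \<in> edge_boundary E (comp_of S u) then prod lam (comp_of S u) else 0)
        + (if f \<in> edge_boundary E (comp_of S v) then prod lam (comp_of S v) else 0)"
    using *(2) edge_cost_pair[OF S] edge_cost_pair[OF T] edge_boundary_pair[of x y E] f
    by (simp add: fe)
qed

lemma edge_cost_antimono: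
  assumes "S \<subseteq> T" "T \<subseteq> E" "f \<in> E"
  shows "edge_cost T f \<le> edge_cost S f"
proof -
  have "finite (T - S)" using assms finite_E finite_subset by blast
  then have "edge_cost (S \<union> (T - S)) f \<le> edge_cost S f" if "T - S \<subseteq> E"
    using that
  proof (induction "T - S" arbitrary: T)
    case empty
    then show ?case by (metis Un_empty_right order_refl)
  next
    case (insert e Z)
    have e: "e \<in> E" and Z: "Z \<subseteq> E" using insert by auto
    obtain u v where uv: "e = {u, v}" using edgeE[OF e] by metis
    have SZ: "S \<union> Z \<subseteq> E" using Z assms by auto
    have "edge_cost (insert e (S \<union> Z)) f \<le> edge_cost (S \<union> Z) f"
      using edge_cost_insert(1)[OF SZ assms(3)] e uv by simp
    moreover have "edge_cost (S \<union> Z) f \<le> edge_cost S f"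
    proof -
      have "Z = (S \<union> Z) - S" using insert.hyps(2,4) by auto
      then show ?thesis using insert.hyps(3)[of "S \<union> Z"] Z by (metis Un_Diff_cancel)
    qed
    moreover have "S \<union> (T - S) = insert e (S \<union> Z)" using insert.hyps(4) by auto
    ultimately show ?case by simp
  qed
  moreover have "S \<union> (T - S) = T" using assms by auto
  ultimately show ?thesis using assms by auto
qed

abbreviation w :: "'v set set \<Rightarrow> real" where
  "w \<equiv> rc_weight V E p lam"

lemma w_pos: "S \<subseteq> E \<Longrightarrow> 0 < w S"
  by (rule rc_weight_pos[OF graph]) (use p_range lam_pos in auto)

text \<open>Adding \<open>e\<close> trades the factor \<open>1 - p e\<close> for \<open>p e\<close>
  and divides the cluster weight by \<open>1 + edge_cost S e\<close>.\<close>

lemma w_insert: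
  assumes S: "S \<subseteq> E - {e}" and e: "e \<in> E"
  shows "p e * w S = (1 - p e) * (1 + edge_cost S e) * w (insert e S)"
proof -
  have iS: "insert e S \<subseteq> E" using S e by auto
  have finS: "finite S" "finite (E - S)" using S finite_E finite_subset by auto
  have "(\<Prod>f\<in>E - S. 1 - p f) = (1 - p e) * (\<Prod>f\<in>E - S - {e}. 1 - p f)"
    using S e finS by (intro prod.remove) auto
  moreover have "E - S - {e} = E - insert e S" by auto
  moreover have "(\<Prod>f\<in>insert e S. p f) = p e * (\<Prod>f\<in>S. p f)"
    using S finS by (intro prod.insert) auto
  moreover have "cluster_weight S = (1 + edge_cost S e) * cluster_weight (insert e S)"
    using cluster_weight_pos[OF iS] by (simp add: edge_cost_def)
  ultimately show ?thesis
    unfolding rc_weight_def cluster_weight_def by simp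
qed

text \<open>The probability that \<open>glauber\<close> makes \<open>e\<close> present, kept in its
  literal form so that the operator of the chain matches by unfolding; \<open>flip_prob_eq\<close>
  gives the explicit formula.\<close>

definition flip_prob :: "'v set \<Rightarrow> 'v set set \<Rightarrow> real" where
  "flip_prob e X = pmf (random_cluster V E p lam) (X \<union> {e}) /
    (pmf (random_cluster V E p lam) (X \<union> {e}) + pmf (random_cluster V E p lam) (X - {e}))"

lemma partition_function_pos: "0 < (\<Sum>T\<in>Pow E. w T)"
  using finite_E by (intro sum_pos) (auto intro: w_pos)

lemma flip_prob_weight:
  assumes "e \<in> E" "X \<subseteq> E"
  shows "flip_prob e X = w (insert e X) / (w (insert e X) + w (X - {e}))"
proof -
  have "X \<union> {e} \<subseteq> E" "X - {e} \<subseteq> E" using assms by auto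
  then show ?thesis
    using partition_function_pos
    by (simp add: flip_prob_def pmf_random_cluster[OF graph p_range lam_pos] flip: add_divide_distrib)
qed

lemma flip_prob_eq:
  assumes "e \<in> E" "X \<subseteq> E"
  shows "flip_prob e X = p e / (p e + (1 - p e) * (1 + edge_cost (X - {e}) e))"
proof -
  let ?S = "X - {e}"
  have pe: "0 < p e" "p e < 1" using p_range[OF assms(1)] by auto
  have S: "?S \<subseteq> E" "?S \<subseteq> E - {e}" using assms by auto
  have W: "0 < w (insert e X)" using assms by (intro w_pos) auto
  have "p e * w ?S = (1 - p e) * (1 + edge_cost ?S e) * w (insert e X)"
    using w_insert[OF S(2) assms(1)] by simp
  then have wS: "w ?S = (1 - p e) * (1 + edge_cost ?S e) * w (insert e X) / p e"
    using pe by (simp add: field_simps)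
  let ?c = "(1 - p e) * (1 + edge_cost ?S e)"
  have "w (insert e X) + w ?S = w (insert e X) * (p e + ?c) / p e"
    unfolding wS using pe by (simp add: field_simps)
  then show ?thesis
    unfolding flip_prob_weight[OF assms] using W pe by simp
qed

lemma flip_prob_mono_bound:
  assumes e: "e \<in> E" and YX: "Y \<subseteq> X" "X \<subseteq> E"
  shows "flip_prob e Y \<le> flip_prob e X"
    and "flip_prob e X - flip_prob e Y \<le> \<theta> * (edge_cost (Y - {e}) e - edge_cost (X - {e}) e)"
proof -
  let ?a = "edge_cost (X - {e}) e" and ?b = "edge_cost (Y - {e}) e"
  let ?q = "1 - p e"
  have pe: "0 < p e" "0 < ?q" "?q \<le> \<theta>" using p_range[OF e] p_ge[OF e] by auto
  have ab: "0 \<le> ?a" "?a \<le> ?b"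
    using edge_cost_bounds[of "X - {e}" e] edge_cost_antimono[of "Y - {e}" "X - {e}" e] YX e by auto
  let ?da = "p e + ?q * (1 + ?a)" and ?db = "p e + ?q * (1 + ?b)"
  have "0 \<le> ?q * ?a" "0 \<le> ?q * ?b" using pe ab by auto
  \<comment> \<open>Both denominators are 1 plus a nonnegative term, so dropping them from the
    difference of the two fractions gives an upper bound.\<close>
  then have d: "1 \<le> ?da" "1 \<le> ?db" by (simp_all add: algebra_simps)
  then have dd: "1 \<le> ?da * ?db" using mult_mono[of 1 ?da 1 ?db] by simp
  have ne: "?da \<noteq> 0" "?db \<noteq> 0" using d by linarith+
  have "flip_prob e X - flip_prob e Y = p e / ?da - p e / ?db"
    using YX e by (simp add: flip_prob_eq)
  also have "\<dots> = p e * ?q * (?b - ?a) / (?da * ?db)"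
    by (subst diff_frac_eq[OF ne]) (simp add: algebra_simps)
  finally have eq: "flip_prob e X - flip_prob e Y = p e * ?q * (?b - ?a) / (?da * ?db)" .
  have nn: "0 \<le> p e * ?q * (?b - ?a)" using pe ab by (intro mult_nonneg_nonneg) auto
  then have "0 \<le> p e * ?q * (?b - ?a) / (?da * ?db)" using dd by (intro divide_nonneg_nonneg) auto
  then show "flip_prob e Y \<le> flip_prob e X" using eq by simp
  have "p e * ?q * (?b - ?a) / (?da * ?db) \<le> p e * ?q * (?b - ?a) / 1"
    using nn dd by (intro divide_left_mono) auto
  also have "p e * ?q \<le> 1 * \<theta>"
    using pe p_range[OF e] by (intro mult_mono) auto
  then have "p e * ?q * (?b - ?a) / 1 \<le> 1 * \<theta> * (?b - ?a)"
    using ab by (auto intro: mult_right_mono)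
  finally show "flip_prob e X - flip_prob e Y \<le> \<theta> * (?b - ?a)" using eq by simp
qed

text \<open>The third bound rests on the cost being at most 1, hence the factor 2. From here on
  \<open>2 * \<theta>\<close> plays the part of \<open>q\<close> in the bounds for absent
  edges.\<close>

lemma flip_prob_range:
  assumes e: "e \<in> E" and X: "X \<subseteq> E"
  shows "0 \<le> flip_prob e X" "flip_prob e X \<le> 1" "1 - flip_prob e X \<le> 2 * \<theta>"
proof -
  let ?a = "edge_cost (X - {e}) e" and ?q = "1 - p e"
  have pe: "0 < p e" "0 < ?q" "?q \<le> \<theta>" using p_range[OF e] p_ge[OF e] by auto
  have a: "0 \<le> ?a" "?a \<le> 1" using edge_cost_bounds[of "X - {e}" e] X e by auto
  have qa: "0 \<le> ?q * ?a" "?q * ?a \<le> ?q * 1" using pe a by (auto intro: mult_left_mono)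
  let ?d = "p e + ?q * (1 + ?a)"
  have d: "?d = 1 + ?q * ?a" by (simp add: algebra_simps)
  have d1: "1 \<le> ?d" using d qa by simp
  show "0 \<le> flip_prob e X" "flip_prob e X \<le> 1"
    using d1 pe qa d by (auto simp: flip_prob_eq[OF e X])
  have "1 - flip_prob e X = ?q * (1 + ?a) / ?d"
    unfolding flip_prob_eq[OF e X] using d1 by (simp add: field_simps)
  also have "\<dots> \<le> ?q * (1 + ?a) / 1"
    using d1 pe a by (intro divide_left_mono) auto
  also have "\<dots> \<le> 2 * \<theta>" using qa pe by (simp add: algebra_simps)
  finally show "1 - flip_prob e X \<le> 2 * \<theta>" .
qed

sublocale monotone_heat_bath E flip_prob
  using finite_E edges_nonempty flip_prob_range flip_prob_mono_bound(1)
  by unfold_locales auto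

section \<open>Good configurations and the contraction estimate\<close>

abbreviation n :: real where "n \<equiv> real (card V)"
abbreviation m :: real where "m \<equiv> real (card E)"

text \<open>The complement of the rare event in which the contraction may fail. Additional edges
  only remove vertex sets from the condition, so goodness passes to larger configurations.\<close>

definition good :: "'v set set \<Rightarrow> bool" where
  "good Y \<longleftrightarrow> (\<forall>A\<subseteq>V. A \<noteq> {} \<longrightarrow> edge_boundary E A \<inter> Y = {} \<longrightarrow>
     real (card (edge_boundary E A)) \<le> 4 * real (card A) * ln n)"

lemma good_mono: "good Y \<Longrightarrow> Y \<subseteq> X \<Longrightarrow> good X"
  unfolding good_def by blast

text \<open>Bounds the part of the total cost change that is due to the endpoint \<open>u\<close> of
  an added edge. Deleting \<open>f\<close> first reflects that the update probability of
  \<open>f\<close> depends on \<open>Y - {f}\<close>.\<close>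

definition separation_sum :: "'v set set \<Rightarrow> 'v \<Rightarrow> real" where
  "separation_sum Y u = (\<Sum>f\<in>E. if f \<in> edge_boundary E (comp_of (Y - {f}) u)
     then prod lam (comp_of (Y - {f}) u) else 0)"

lemma separation_sum_le:
  assumes Y: "Y \<subseteq> E" "good Y" and u: "u \<in> V" and n: "1 \<le> n"
  shows "separation_sum Y u \<le> (1 + 4 * ln n) / (1 - L)"
proof -
  let ?t = "\<lambda>f. if f \<in> edge_boundary E (comp_of (Y - {f}) u)
     then prod lam (comp_of (Y - {f}) u) else 0"
  have ln0: "0 \<le> ln n" using n by simp
  \<comment> \<open>For \<open>f\<close> outside \<open>Y\<close> the component is always that of
    \<open>u\<close> in \<open>Y\<close>. Its boundary avoids \<open>Y\<close>, so goodness limits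
    the number of terms; each is at most \<open>L ^ card ?A\<close>, and
    \<open>s * L ^ s \<le> 1 / (1 - L)\<close>.\<close>
  have "sum ?t (E - Y) \<le> 4 * ln n / (1 - L)"
  proof -
    let ?A = "comp_of Y u"
    have A: "?A \<subseteq> V" "?A \<noteq> {}" using comp_subset[OF Y(1) u] comp_of_self[of u Y] by auto
    have "edge_boundary E ?A \<inter> Y = {}"
    proof (rule ccontr)
      assume "edge_boundary E ?A \<inter> Y \<noteq> {}"
      then obtain f where f: "f \<in> edge_boundary E ?A" "f \<in> Y" by blast
      then obtain x y where xy: "f = {x, y}" using Y edgeE[of f] by blast
      then have "(x \<in> ?A) \<noteq> (y \<in> ?A)" using f Y edge_boundary_pair[of x y E ?A] by auto
      then show False using comp_of_step[of _ Y u] f xy by (metis insert_commute)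
    qed
    then have cd: "real (card (edge_boundary E ?A)) \<le> 4 * real (card ?A) * ln n"
      using Y(2) A unfolding good_def by blast
    have "sum ?t (E - Y) = (\<Sum>f\<in>E - Y. if f \<in> edge_boundary E ?A then prod lam ?A else 0)"
      by (rule sum.cong) auto
    also have "\<dots> = (\<Sum>f\<in>(E - Y) \<inter> edge_boundary E ?A. prod lam ?A)"
      using finite_E by (intro sum.inter_restrict[symmetric]) auto
    also have "\<dots> = real (card ((E - Y) \<inter> edge_boundary E ?A)) * prod lam ?A" by simp
    also have "\<dots> \<le> real (card (edge_boundary E ?A)) * prod lam ?A"
    proof (intro mult_right_mono)
      have "finite (edge_boundary E ?A)" using finite_E by (simp add: edge_boundary_def)
      then show "real (card ((E - Y) \<inter> edge_boundary E ?A)) \<le> real (card (edge_boundary E ?A))"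
        by (intro of_nat_mono card_mono) auto
    qed (use prod_lam_pos[OF A(1)] in simp)
    also have "\<dots> \<le> (4 * real (card ?A) * ln n) * L ^ card ?A"
      using cd prod_lam_le[OF A(1)] prod_lam_pos[OF A(1)] ln0 by (intro mult_mono) auto
    also have "\<dots> = 4 * ln n * (real (card ?A) * L ^ card ?A)" by simp
    also have "\<dots> \<le> 4 * ln n * (1 / (1 - L))"
      using nat_mult_power_le[of L "card ?A"] L_pos L_less_1 ln0 by (intro mult_left_mono) auto
    finally show ?thesis by simp
  qed
  \<comment> \<open>For \<open>f\<close> in \<open>Y\<close> the component varies with
    \<open>f\<close>, and \<open>card_separating_edges_le\<close> supplies the rank condition that
    makes the sum geometric.\<close>
  moreover have "sum ?t Y \<le> 1 / (1 - L)"
  proof -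
    let ?F = "{f \<in> Y. f \<in> edge_boundary Y (comp_of (Y - {f}) u)}"
    have finY: "finite Y" using Y finite_E finite_subset by blast
    have "sum ?t Y = (\<Sum>f\<in>Y. if f \<in> ?F then prod lam (comp_of (Y - {f}) u) else 0)"
      using Y by (intro sum.cong) (auto simp: edge_boundary_def)
    also have "\<dots> = (\<Sum>f\<in>Y \<inter> ?F. prod lam (comp_of (Y - {f}) u))"
      using finY by (intro sum.inter_restrict[symmetric])
    also have "Y \<inter> ?F = ?F" by auto
    also have "(\<Sum>f\<in>?F. prod lam (comp_of (Y - {f}) u)) \<le> (\<Sum>f\<in>?F. L ^ card (comp_of (Y - {f}) u))"
      using Y u by (intro sum_mono prod_lam_le comp_subset) auto
    also have "\<dots> \<le> 1 / (1 - L)"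
    proof (rule sum_power_rank_le)
      fix s
      have "{f \<in> ?F. card (comp_of (Y - {f}) u) \<le> s} =
          {f \<in> Y. f \<in> edge_boundary Y (comp_of (Y - {f}) u) \<and> card (comp_of (Y - {f}) u) \<le> s}"
        by auto
      also have "card \<dots> \<le> s"
        using graph Y u finite_V by (intro card_separating_edges_le[of Y V]) (auto simp: simple_graph_def)
      finally show "card {f \<in> ?F. card (comp_of (Y - {f}) u) \<le> s} \<le> s" .
    qed (use finY L_pos L_less_1 in auto)
    finally show ?thesis .
  qed
  moreover have "separation_sum Y u = sum ?t (E - Y) + sum ?t Y"
    unfolding separation_sum_def by (rule sum.subset_diff[OF Y(1) finite_E])
  ultimately show ?thesis by (simp add: add_divide_distrib)
qed

lemma edge_cost_sum_insert:
  assumes Y: "Y \<subseteq> E" "good Y" and e: "e \<in> E - Y" and n: "1 \<le> n"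
  shows "(\<Sum>f\<in>E. edge_cost (Y - {f}) f - edge_cost (insert e Y - {f}) f)
    \<le> 2 * (1 + 4 * ln n) / (1 - L)"
proof -
  obtain u v where uv: "e = {u, v}" "u \<in> V" "v \<in> V" using edgeE e by blast
  let ?t = "\<lambda>u f. if f \<in> edge_boundary E (comp_of (Y - {f}) u)
     then prod lam (comp_of (Y - {f}) u) else 0"
  have nn: "0 \<le> ?t u f" if "u \<in> V" for u f
  proof -
    have "Y - {f} \<subseteq> E" using Y by auto
    then show ?thesis using prod_lam_pos[OF comp_subset[OF _ that]] by (simp add: less_imp_le)
  qed
  have "(\<Sum>f\<in>E. edge_cost (Y - {f}) f - edge_cost (insert e Y - {f}) f)
      \<le> (\<Sum>f\<in>E. ?t u f + ?t v f)"
  proof (rule sum_mono)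
    fix f assume f: "f \<in> E"
    show "edge_cost (Y - {f}) f - edge_cost (insert e Y - {f}) f \<le> ?t u f + ?t v f"
    \<comment> \<open>The update of \<open>e\<close> ignores the current status of \<open>e\<close>,
      so the two costs coincide.\<close>
    proof (cases "f = e")
      case True
      then have "insert e Y - {f} = Y - {f}" by auto
      then have eq: "edge_cost (Y - {f}) f - edge_cost (insert e Y - {f}) f = 0" by simp
      show ?thesis unfolding eq using nn uv(2,3) by (intro add_nonneg_nonneg)
    next
      case False
      then have "insert e Y - {f} = insert {u, v} (Y - {f})" using uv by auto
      moreover have "Y - {f} \<subseteq> E" "{u, v} \<in> E" using Y e uv by auto
      ultimately show ?thesis using edge_cost_insert(2)[of "Y - {f}" f u v] f by presburger
    qed
  qed
  also have "\<dots> = separation_sum Y u + separation_sum Y v"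
    by (simp add: separation_sum_def sum.distrib)
  also have "\<dots> \<le> (1 + 4 * ln n) / (1 - L) + (1 + 4 * ln n) / (1 - L)"
    using separation_sum_le[OF Y] uv n by (intro add_mono) auto
  also have "\<dots> = 2 * (1 + 4 * ln n) / (1 - L)" by (simp add: field_simps)
  finally show ?thesis .
qed

text \<open>Telescoping over the edges of \<open>X - Y\<close>; the intermediate configurations stay
  good since they contain \<open>Y\<close>.\<close>

lemma edge_cost_sum_le:
  assumes "Y \<subseteq> X" "X \<subseteq> E" "good Y" and n: "1 \<le> n"
  shows "(\<Sum>f\<in>E. edge_cost (Y - {f}) f - edge_cost (X - {f}) f)
    \<le> D X Y * (2 * (1 + 4 * ln n) / (1 - L))"
proof -
  define c where "c = 2 * (1 + 4 * ln n) / (1 - L)"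
  have "(\<Sum>f\<in>E. edge_cost (Y - {f}) f - edge_cost (Y \<union> Z - {f}) f) \<le> real (card Z) * c"
    if "finite Z" "Z \<subseteq> E - Y" for Z
    using that
  proof (induction Z)
    case empty
    then show ?case by simp
  next
    case (insert e Z)
    have YZ: "Y \<union> Z \<subseteq> E" "good (Y \<union> Z)" "e \<in> E - (Y \<union> Z)"
      using insert assms good_mono[of Y "Y \<union> Z"] by auto
    have "(\<Sum>f\<in>E. edge_cost (Y - {f}) f - edge_cost (Y \<union> insert e Z - {f}) f)
        = (\<Sum>f\<in>E. edge_cost (Y - {f}) f - edge_cost (Y \<union> Z - {f}) f)
        + (\<Sum>f\<in>E. edge_cost (Y \<union> Z - {f}) f - edge_cost (insert e (Y \<union> Z) - {f}) f)"
      by (simp add: sum_subtractf)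
    also have "\<dots> \<le> real (card Z) * c + c"
      using insert by (intro add_mono edge_cost_sum_insert[OF YZ n, folded c_def]) auto
    finally show ?case using insert by (simp add: distrib_right add.commute)
  qed
  from this[of "X - Y"] have "(\<Sum>f\<in>E. edge_cost (Y - {f}) f - edge_cost (Y \<union> (X - Y) - {f}) f)
      \<le> D X Y * c"
    using assms finite_E finite_subset[of "X - Y" E] by auto
  moreover have "Y \<union> (X - Y) = X" using assms by auto
  ultimately show ?thesis by (simp add: c_def)
qed

definition bad :: "'v set set \<Rightarrow> real" where
  "bad Y = (if good Y then 0 else 1)"

text \<open>A good \<open>Y\<close> keeps half of the contraction rate \<open>1 / m\<close>.
  Otherwise each difference of update probabilities is at most 1, hence so is their average, and
  this is charged to \<open>bad\<close>.\<close>

lemma drift: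
  assumes K: "27 * (\<theta> * ln n) \<le> 1 - L" and n3: "3 \<le> card V"
    and YX: "Y \<subseteq> X" "X \<subseteq> E"
  shows "Q D X Y \<le> (1 - 1 / (2 * m)) * D X Y + bad Y"
proof -
  have "ln 3 \<le> ln n" using n3 by simp
  then have ln1: "1 \<le> ln n" using ln3_gt_1 by linarith
  have m: "0 < m" by (rule card_E_pos)
  show ?thesis
  proof (cases "good Y")
    case True
    have "(\<Sum>e\<in>E. flip_prob e X - flip_prob e Y)
        \<le> (\<Sum>e\<in>E. \<theta> * (edge_cost (Y - {e}) e - edge_cost (X - {e}) e))"
      by (rule sum_mono) (rule flip_prob_mono_bound(2)[OF _ YX])
    also have "\<dots> = \<theta> * (\<Sum>e\<in>E. edge_cost (Y - {e}) e - edge_cost (X - {e}) e)"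
      by (simp add: sum_distrib_left)
    also have "\<dots> \<le> \<theta> * (D X Y * (2 * (1 + 4 * ln n) / (1 - L)))"
      using \<theta>_pos n3 by (intro mult_left_mono edge_cost_sum_le[OF YX True]) auto
    also have "\<dots> \<le> D X Y * (1 / 2)"
    proof -
      \<comment> \<open>\<open>ln n \<ge> 1\<close> absorbs the summand 1, and
        \<open>10 / 27 \<le> 1 / 2\<close> turns the hypothesis \<open>K\<close> into half of the
        contraction.\<close>
      have "\<theta> * (2 * (1 + 4 * ln n)) \<le> \<theta> * (10 * ln n)"
        using ln1 \<theta>_pos by (intro mult_left_mono) auto
      also have "\<dots> \<le> (1 - L) * (1 / 2)" using K L_less_1 by simp
      finally have "\<theta> * (2 * (1 + 4 * ln n)) / (1 - L) \<le> 1 / 2"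
        using L_less_1 by (subst pos_divide_le_eq) (auto simp: mult.commute)
      then have "D X Y * (\<theta> * (2 * (1 + 4 * ln n)) / (1 - L)) \<le> D X Y * (1 / 2)"
        by (intro mult_left_mono) auto
      then show ?thesis by (simp add: mult_ac)
    qed
    finally have "(\<Sum>e\<in>E. flip_prob e X - flip_prob e Y) / m \<le> D X Y * (1 / 2) / m"
      using m by (intro divide_right_mono) auto
    then show ?thesis using m True by (simp add: Q_D[OF YX] bad_def field_simps)
  next
    case False
    have "(\<Sum>e\<in>E. flip_prob e X - flip_prob e Y) \<le> (\<Sum>e\<in>E. 1)"
    proof (rule sum_mono)
      fix e assume e: "e \<in> E"
      show "flip_prob e X - flip_prob e Y \<le> 1"
        using prob_le_1[OF e YX(2)] prob_nonneg[OF e order_trans[OF YX]] by linarith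
    qed
    then have "(\<Sum>e\<in>E. flip_prob e X - flip_prob e Y) / m \<le> 1"
      using m by (subst pos_divide_le_eq) auto
    moreover have "(1 - 1 / m) * D X Y \<le> (1 - 1 / (2 * m)) * D X Y"
      using m by (intro mult_right_mono) (auto simp: field_simps)
    ultimately show ?thesis using False by (simp add: Q_D[OF YX] bad_def)
  qed
qed

section \<open>Union bound over vertex sets with many boundary edges\<close>

definition dense_sets :: "'v set set" where
  "dense_sets = {A \<in> Pow V. A \<noteq> {} \<and> 4 * real (card A) * ln n < real (card (edge_boundary E A))}"

lemma bad_le: "bad Y \<le> (\<Sum>A\<in>dense_sets. absent (edge_boundary E A) Y)"
proof (cases "good Y")
  case True
  then show ?thesis by (auto simp: bad_def absent_def intro!: sum_nonneg)
next
  case False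
  then obtain A where A: "A \<in> dense_sets" "edge_boundary E A \<inter> Y = {}"
  proof -
    obtain A where "A \<subseteq> V" "A \<noteq> {}" "edge_boundary E A \<inter> Y = {}"
      "\<not> real (card (edge_boundary E A)) \<le> 4 * real (card A) * ln n"
      using False unfolding good_def by blast
    then show ?thesis using that[of A] by (simp add: dense_sets_def)
  qed
  have "finite dense_sets" using finite_V by (simp add: dense_sets_def)
  then have "absent (edge_boundary E A) Y \<le> (\<Sum>A\<in>dense_sets. absent (edge_boundary E A) Y)"
    using A(1) by (intro member_le_sum) (auto simp: absent_def)
  then show ?thesis using A(2) False by (simp add: bad_def absent_def)
qed

text \<open>A set of \<open>s\<close> vertices contributes at most
  \<open>\<kappa> / n ^ (8 * s)\<close>, which beats the number of such sets. Summing over all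
  nonempty \<open>A\<close> at once gives \<open>(1 + 1 / n ^ 8) ^ n - 1\<close>, which is of order
  \<open>1 / n ^ 7\<close>.\<close>

lemma dense_sets_sum_le:
  fixes x \<kappa> :: real
  assumes n3: "3 \<le> card V" and x0: "0 \<le> x" and \<kappa>: "0 \<le> \<kappa>"
    and x: "\<And>k s. 1 \<le> s \<Longrightarrow> 4 * real s * ln n < real k \<Longrightarrow> x ^ k \<le> \<kappa> * (1 / n ^ 8) ^ s"
  shows "(\<Sum>A\<in>dense_sets. x ^ card (edge_boundary E A)) \<le> 2 * \<kappa> / n ^ 7"
proof -
  let ?y = "1 / n ^ 8"
  have n: "3 \<le> n" using n3 by simp
  have y: "0 \<le> ?y" by simp
  have "(\<Sum>A\<in>dense_sets. x ^ card (edge_boundary E A)) \<le> (\<Sum>A\<in>dense_sets. \<kappa> * ?y ^ card A)"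
  proof (rule sum_mono)
    fix A assume A: "A \<in> dense_sets"
    then have "finite A" "A \<noteq> {}" using finite_V finite_subset by (auto simp: dense_sets_def)
    then have "1 \<le> card A" by (simp add: card_gt_0_iff Suc_leI)
    then show "x ^ card (edge_boundary E A) \<le> \<kappa> * ?y ^ card A"
      using x[of "card A" "card (edge_boundary E A)"] A by (simp add: dense_sets_def)
  qed
  also have "\<dots> = \<kappa> * (\<Sum>A\<in>dense_sets. ?y ^ card A)" by (simp add: sum_distrib_left)
  also have "(\<Sum>A\<in>dense_sets. ?y ^ card A) \<le> (\<Sum>A\<in>Pow V - {{}}. ?y ^ card A)"
    using finite_V y by (intro sum_mono2) (auto simp: dense_sets_def)
  also have "(\<Sum>A\<in>Pow V - {{}}. ?y ^ card A) = (1 + ?y) ^ card V - 1"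
  proof -
    have "(\<Sum>A\<in>Pow V. ?y ^ card A) = (?y + 1) ^ card V"
      using prod_add[OF finite_V, of "\<lambda>_. ?y" "\<lambda>_. 1"] by simp
    moreover have "(\<Sum>A\<in>Pow V. ?y ^ card A) = ?y ^ card ({}::'v set) + (\<Sum>A\<in>Pow V - {{}}. ?y ^ card A)"
      using finite_V by (intro sum.remove) auto
    ultimately show ?thesis by (simp add: add.commute)
  qed
  \<comment> \<open>Uses \<open>1 + y \<le> exp y\<close>, and then
    \<open>exp z - 1 \<le> z + z ^ 2 \<le> 2 * z\<close> on the unit interval.\<close>
  also have "\<dots> \<le> 2 * (n * ?y)"
  proof -
    have ny: "n * ?y = 1 / n ^ 7" using n by (simp add: field_simps eval_nat_numeral)
    have ny1: "0 \<le> n * ?y" "n * ?y \<le> 1" unfolding ny using n by (auto simp: one_le_power)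
    have "(1 + ?y) ^ card V \<le> exp ?y ^ card V"
      using y by (intro power_mono) (auto simp: exp_ge_add_one_self)
    also have "\<dots> = exp (n * ?y)" by (rule exp_of_nat_mult[symmetric])
    also have "\<dots> \<le> 1 + n * ?y + (n * ?y)\<^sup>2" by (rule exp_bound[OF ny1])
    also have "(n * ?y)\<^sup>2 \<le> n * ?y" using ny1 by (simp only: power2_eq_square mult_left_le)
    finally show ?thesis by simp
  qed
  finally have "(\<Sum>A\<in>dense_sets. x ^ card (edge_boundary E A)) \<le> \<kappa> * (2 * (n * ?y))"
    using \<kappa> by (simp add: mult_left_mono)
  also have "\<kappa> * (2 * (n * ?y)) = 2 * \<kappa> / n ^ 7"
    using n by (simp add: field_simps eval_nat_numeral)
  finally show ?thesis .
qed

lemma twice_edges_le: "2 * m \<le> n ^ 2"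
proof -
  have "E \<subseteq> {A. A \<subseteq> V \<and> card A = 2}" using graph by (auto simp: simple_graph_def)
  then have "card E \<le> card {A. A \<subseteq> V \<and> card A = 2}"
    using finite_V by (intro card_mono) auto
  also have "\<dots> = card V choose 2" by (rule n_subsets[OF finite_V])
  finally have "2 * card E \<le> card V * (card V - 1)" by (simp add: choose_two)
  also have "\<dots> \<le> card V * card V" by simp
  finally have "real (2 * card E) \<le> real (card V * card V)" by (rule of_nat_mono)
  then show ?thesis by (simp add: power2_eq_square)
qed

text \<open>Two different edges span at least three vertices; this yields
  \<open>ln n \<ge> 1\<close> in the estimates.\<close>

lemma card_V_ge_3:
  assumes "2 \<le> card E"
  shows "3 \<le> card V"
proof -
  obtain e f where ef: "e \<in> E" "f \<in> E" "e \<noteq> f"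
    using assms by (metis card_le_Suc0_iff_eq finite_E not_less_eq_eq numeral_2_eq_2)
  then have c: "card e = 2" "card f = 2" "e \<subseteq> V" "f \<subseteq> V" using graph by (auto simp: simple_graph_def)
  then have fin: "finite e" "finite f" using card.infinite by fastforce+
  have "e \<subset> e \<union> f"
  proof -
    have "\<not> f \<subseteq> e" using card_subset_eq[of e f] c fin ef by auto
    then show ?thesis by auto
  qed
  then have "card e < card (e \<union> f)" using fin by (intro psubset_card_mono) auto
  also have "\<dots> \<le> card V" using c finite_V by (intro card_mono) auto
  finally show ?thesis using c by simp
qed

section \<open>The stationary measure and total variation\<close>

abbreviation \<mu> :: "'v set set pmf" where "\<mu> \<equiv> random_cluster V E p lam"

definition mu :: "'v set set \<Rightarrow> real" where
  "mu X = w X / (\<Sum>T\<in>Pow E. w T)"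

lemma mu_nonneg: "X \<subseteq> E \<Longrightarrow> 0 \<le> mu X"
  using w_pos[of X] partition_function_pos by (simp add: mu_def less_imp_le)

lemma sum_mu: "(\<Sum>X\<in>Pow E. mu X) = 1"
  using partition_function_pos by (simp add: mu_def flip: sum_divide_distrib)

lemma pmf_\<mu>: "pmf \<mu> X = (if X \<subseteq> E then mu X else 0)"
  by (subst pmf_random_cluster[OF graph]) (auto simp: mu_def p_range lam_pos)

lemma expectation_\<mu>:
  fixes f :: "'v set set \<Rightarrow> real"
  shows "measure_pmf.expectation \<mu> f = (\<Sum>X\<in>Pow E. mu X * f X)"
proof -
  have "measure_pmf.expectation \<mu> f = (\<Sum>X\<in>Pow E. f X * pmf \<mu> X)"
    using finite_E by (intro integral_measure_pmf_real) (auto simp: set_pmf_eq pmf_\<mu> split: if_splits)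
  also have "\<dots> = (\<Sum>X\<in>Pow E. mu X * f X)"
    by (rule sum.cong) (auto simp: pmf_\<mu>)
  finally show ?thesis .
qed

lemma stationary: "(\<Sum>X\<in>Pow E. mu X * (G ^^ t) f X) = (\<Sum>X\<in>Pow E. mu X * f X)"
  using heat_bath_iter_stationary[of E w flip_prob t f] finite_E edges_nonempty w_pos flip_prob_weight
  by (simp add: mu_def flip: sum_divide_distrib)

lemma expectation_chain:
  fixes f :: "'v set set \<Rightarrow> real"
  assumes "X \<subseteq> E"
  shows "measure_pmf.expectation (chain_dist (glauber E \<mu>) t X) f = (G ^^ t) f X"
proof -
  have "flip_prob = (\<lambda>e X. pmf \<mu> (X \<union> {e}) / (pmf \<mu> (X \<union> {e}) + pmf \<mu> (X - {e})))"
    by (intro ext) (simp add: flip_prob_def)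
  then show ?thesis using expectation_chain_dist_glauber[OF finite_E edges_nonempty assms] by simp
qed

text \<open>By stationarity, the \<open>\<mu>\<close>-probability of \<open>A\<close> is the
  \<open>mu\<close>-average over \<open>Y\<close> of the probability of \<open>A\<close> after
  \<open>t\<close> steps from \<open>Y\<close>. So it suffices to compare the start \<open>X\<close>
  with each start \<open>Y\<close> and to average.\<close>

lemma tv_dist_chain_le:
  assumes X: "X \<subseteq> E"
    and b: "\<And>A Y. Y \<subseteq> E \<Longrightarrow> \<bar>(G ^^ t) (indicator A) X - (G ^^ t) (indicator A) Y\<bar> \<le> b Y"
  shows "tv_dist (chain_dist (glauber E \<mu>) t X) \<mu> \<le> (\<Sum>Y\<in>Pow E. mu Y * b Y)"
proof (rule tv_dist_le)
  fix A :: "'v set set set"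
  let ?f = "indicator A :: _ \<Rightarrow> real"
  let ?d = "\<lambda>Y. mu Y * ((G ^^ t) ?f X - (G ^^ t) ?f Y)"
  have "measure_pmf.expectation (chain_dist (glauber E \<mu>) t X) ?f - measure_pmf.expectation \<mu> ?f
      = (\<Sum>Y\<in>Pow E. mu Y) * (G ^^ t) ?f X - (\<Sum>Y\<in>Pow E. mu Y * (G ^^ t) ?f Y)"
    by (simp only: expectation_chain[OF X] expectation_\<mu> stationary sum_mu mult_1_left)
  also have "\<dots> = sum ?d (Pow E)"
    by (simp add: sum_distrib_right right_diff_distrib sum_subtractf)
  finally have eq: "measure_pmf.expectation (chain_dist (glauber E \<mu>) t X) ?f
      - measure_pmf.expectation \<mu> ?f = sum ?d (Pow E)" .
  have "\<bar>sum ?d (Pow E)\<bar> \<le> (\<Sum>Y\<in>Pow E. \<bar>?d Y\<bar>)"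
    by (rule sum_abs)
  also have "\<dots> \<le> (\<Sum>Y\<in>Pow E. mu Y * b Y)"
  proof (rule sum_mono)
    fix Y assume "Y \<in> Pow E"
    then have Y: "Y \<subseteq> E" by simp
    have "mu Y * \<bar>(G ^^ t) ?f X - (G ^^ t) ?f Y\<bar> \<le> mu Y * b Y"
      by (rule mult_left_mono[OF b[OF Y] mu_nonneg[OF Y]])
    then show "\<bar>?d Y\<bar> \<le> mu Y * b Y"
      unfolding abs_mult abs_of_nonneg[OF mu_nonneg[OF Y]] .
  qed
  finally show "\<bar>measure_pmf.expectation (chain_dist (glauber E \<mu>) t X) ?f
      - measure_pmf.expectation \<mu> ?f\<bar> \<le> (\<Sum>Y\<in>Pow E. mu Y * b Y)"
    unfolding eq .
qed

text \<open>One update of the only edge forgets the start. This case is kept apart because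
  \<open>ln m = 0\<close>.\<close>

lemma tv_dist_single_edge:
  assumes "card E = 1" and X: "X \<subseteq> E"
  shows "tv_dist (chain_dist (glauber E \<mu>) 1 X) \<mu> \<le> 0"
proof -
  obtain e where e: "E = {e}" using assms by (auto simp: card_1_singleton_iff)
  then have eE: "e \<in> E" by simp
  have sum_E: "sum h E = h e" for h :: "'v set \<Rightarrow> real" using e by simp
  have "G f X = G f Y" if Y: "Y \<subseteq> E" for f Y
  proof -
    have eqs: "X - {e} = {}" "Y - {e} = {}" "insert e X = {e}" "insert e Y = {e}"
      using X Y e by auto
    have "flip_prob e X = flip_prob e Y"
      unfolding flip_prob_eq[OF eE X] flip_prob_eq[OF eE Y] by (simp only: eqs)
    then show ?thesis unfolding heat_bath_def sum_E by (simp only: eqs)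
  qed
  then show ?thesis using tv_dist_chain_le[OF X, of 1 "\<lambda>_. 0"] by simp
qed

text \<open>With \<open>k > 4 * s * ln n\<close>, the 2 in the exponent yields
  \<open>1 / n ^ (8 * s)\<close>, and the summand \<open>c / ln n\<close> yields
  \<open>exp (- (4 * s * c))\<close>, of which \<open>exp (- c)\<close> is kept. The choice
  \<open>c = ln (8 / \<epsilon>)\<close> accounts for the exponential factor in the second bound on
  \<open>K\<close>.\<close>

lemma power_boundary_le:
  assumes n: "1 < n" and x: "0 \<le> x" "x \<le> exp (- (2 + c / ln n))" and c: "0 \<le> c"
    and s: "1 \<le> s" and k: "4 * real s * ln n < real k"
  shows "x ^ k \<le> exp (- c) * (1 / n ^ 8) ^ s"
proof -
  have ln: "0 < ln n" using n by simp
  have "x ^ k \<le> exp (- (2 + c / ln n)) ^ k" using x by (intro power_mono)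
  also have "\<dots> = exp (real k * - (2 + c / ln n))" by (rule exp_of_nat_mult[symmetric])
  also have "\<dots> \<le> exp (- c + real (8 * s) * - ln n)"
  proof -
    have "4 * real s * ln n * (2 + c / ln n) \<le> real k * (2 + c / ln n)"
      using k c ln by (intro mult_right_mono) auto
    moreover have "4 * real s * ln n * (2 + c / ln n) = 8 * real s * ln n + 4 * real s * c"
      using ln by (simp add: field_simps)
    moreover have "1 * c \<le> 4 * real s * c" using s c by (intro mult_right_mono) auto
    ultimately have "c + 8 * real s * ln n \<le> real k * (2 + c / ln n)" by linarith
    then show ?thesis
      unfolding exp_le_cancel_iff mult_minus_right of_nat_mult of_nat_numeral by linarith
  qed
  also have "\<dots> = exp (- c) * exp (- ln n) ^ (8 * s)"
    by (simp only: exp_add exp_of_nat_mult)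
  also have "exp (- ln n) = 1 / n" using n by (simp add: exp_minus inverse_eq_divide)
  also have "exp (- c) * (1 / n) ^ (8 * s) = exp (- c) * (1 / n ^ 8) ^ s"
    by (simp add: power_mult power_divide)
  finally show ?thesis .
qed

lemma sum_mu_absent_le:
  assumes F: "F \<subseteq> E"
  shows "(\<Sum>Y\<in>Pow E. mu Y * absent F Y) \<le> (2 * \<theta>) ^ card F"
proof -
  have "w S \<le> 2 * \<theta> * (w S + w (insert e S))" if e: "e \<in> E" and S: "S \<subseteq> E - {e}" for e S
  proof -
    have S': "S \<subseteq> E" "S - {e} = S" using S by auto
    have pos: "0 < w S" "0 < w (insert e S)" using S' e by (auto intro!: w_pos)
    have "1 - flip_prob e S = w S / (w S + w (insert e S))"
      using pos by (simp add: flip_prob_weight[OF e S'(1)] S'(2) field_simps)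
    then have "w S / (w S + w (insert e S)) \<le> 2 * \<theta>" using flip_prob_range(3)[OF e S'(1)] by simp
    then show ?thesis using pos by (simp add: divide_le_eq)
  qed
  then have *: "(\<Sum>X\<in>Pow (E - F). w X) \<le> (2 * \<theta>) ^ card F * (\<Sum>X\<in>Pow E. w X)"
    using \<theta>_pos by (intro stationary_absent_le[OF finite_E w_pos _ _ F]) auto
  have "(\<Sum>Y\<in>Pow E. mu Y * absent F Y) = (\<Sum>Y\<in>Pow E. if Y \<in> Pow (E - F) then mu Y else 0)"
    by (rule sum.cong) (auto simp: absent_def)
  also have "\<dots> = (\<Sum>Y\<in>Pow E \<inter> Pow (E - F). mu Y)"
    using finite_E by (intro sum.inter_restrict[symmetric]) auto
  also have "Pow E \<inter> Pow (E - F) = Pow (E - F)" by auto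
  also have "(\<Sum>Y\<in>Pow (E - F). mu Y) = (\<Sum>X\<in>Pow (E - F). w X) / (\<Sum>X\<in>Pow E. w X)"
    by (simp add: mu_def sum_divide_distrib)
  also have "\<dots> \<le> (2 * \<theta>) ^ card F"
    using * partition_function_pos by (simp add: divide_le_eq)
  finally show ?thesis .
qed

lemma D_le_absent:
  assumes "X \<subseteq> E"
  shows "D X Y \<le> (\<Sum>e\<in>E. absent {e} Y)"
proof -
  have "card (X - Y) \<le> card (E - Y)" using assms finite_E by (intro card_mono) auto
  also have "real (card (E - Y)) = (\<Sum>e\<in>E \<inter> - Y. 1)" by (simp add: Diff_eq)
  also have "\<dots> = (\<Sum>e\<in>E. if e \<in> - Y then 1 else 0)" by (rule sum.inter_restrict[OF finite_E])
  also have "\<dots> = (\<Sum>e\<in>E. absent {e} Y)" by (rule sum.cong) (auto simp: absent_def)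
  finally show ?thesis by simp
qed

text \<open>The accumulated error \<open>\<beta> / (1 - \<alpha>)\<close> of the recursion:
  \<open>1 / (1 - \<alpha>) = 2 * m \<le> n ^ 2\<close> leaves \<open>n ^ 5 \<ge> 243\<close> in the
  denominator.\<close>

lemma twice_edges_bound:
  assumes n: "3 \<le> n" and \<kappa>: "0 \<le> \<kappa>"
  shows "2 * \<kappa> / n ^ 7 / (1 - (1 - 1 / (2 * m))) \<le> 2 * \<kappa> / 243"
proof -
  have m: "0 < m" by (rule card_E_pos)
  have "2 * \<kappa> / n ^ 7 / (1 - (1 - 1 / (2 * m))) = 2 * \<kappa> / n ^ 7 * (2 * m)" using m by simp
  also have "\<dots> \<le> 2 * \<kappa> / n ^ 7 * n ^ 2"
    using twice_edges_le \<kappa> n by (intro mult_left_mono) auto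
  also have "\<dots> = 2 * \<kappa> / n ^ 5" using n by (simp add: field_simps eval_nat_numeral)
  also have "\<dots> \<le> 2 * \<kappa> / 3 ^ 5"
    using n \<kappa> by (intro divide_left_mono power_mono) auto
  finally show ?thesis by simp
qed

section \<open>Number of steps until the total variation distance is small\<close>

lemma ln_n_ge_1: "3 \<le> card V \<Longrightarrow> 1 \<le> ln n"
  using ln3_gt_1 ln_le_cancel_iff[of 3 n] by linarith

lemma fast_mixing_from_all_edges:
  assumes m2: "2 \<le> card E" and K: "27 * (\<theta> * ln n) \<le> 1 - L"
    and K2: "\<theta> * ln n \<le> 1 / 10 ^ 5 * exp (- (ln (8 / \<epsilon>) / ln n))"
    and \<epsilon>: "0 < \<epsilon>" "\<epsilon> < 1 / 4"
  shows "\<exists>t. real t \<le> 2 * m * (ln m + ln (2 / \<epsilon>)) \<and> tv_dist (chain_dist (glauber E \<mu>) t E) \<mu> < \<epsilon>"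
proof -
  have n3: "3 \<le> card V" "3 \<le> n" using card_V_ge_3[OF m2] by auto
  have ln1: "1 \<le> ln n" by (rule ln_n_ge_1[OF n3(1)])
  have m: "2 \<le> m" using m2 by simp
  define \<alpha> where "\<alpha> = 1 - 1 / (2 * m)"
  have \<alpha>: "0 \<le> \<alpha>" "\<alpha> < 1" using m by (auto simp: \<alpha>_def field_simps)
  define \<beta> where "\<beta> = 2 * (\<epsilon> / 8) / n ^ 7"
  have \<beta>: "0 \<le> \<beta>" using \<epsilon> by (simp add: \<beta>_def)
  \<comment> \<open>With this \<open>c\<close> the mean of \<open>bad\<close> carries a factor
    \<open>exp (- c) = \<epsilon> / 8\<close>, so its accumulated contribution is a small fraction
    of \<open>\<epsilon>\<close>.\<close>
  define c where "c = ln (8 / \<epsilon>)"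
  have c: "0 \<le> c" "exp (- c) = \<epsilon> / 8"
  proof -
    have "1 \<le> 8 / \<epsilon>" using \<epsilon> by (simp add: field_simps)
    then show "0 \<le> c" unfolding c_def by (rule ln_ge_zero)
    show "exp (- c) = \<epsilon> / 8" unfolding c_def exp_minus using \<epsilon> by (subst exp_ln) auto
  qed
  have \<theta>1: "\<theta> \<le> 1 / 10 ^ 5 * exp (- (c / ln n))"
    using K2[folded c_def] mult_left_mono[OF ln1, of \<theta>] \<theta>_pos by linarith
  have "1 / 10 ^ 5 * exp (- (c / ln n)) \<le> 1 / 10 ^ 5 * 1"
    using c ln1 by (intro mult_left_mono) auto
  then have \<theta>5: "\<theta> \<le> 1 / 10 ^ 5" using \<theta>1 by linarith
  have e2: "1 / 9 \<le> exp (- 2 :: real)"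
  proof -
    have "exp (2 :: real) = exp 1 * exp 1" by (simp flip: exp_add)
    also have "\<dots> \<le> 3 * 3" using exp_le by (intro mult_mono) auto
    finally show ?thesis by (simp add: exp_minus field_simps)
  qed
  have x: "2 * \<theta> \<le> exp (- (2 + c / ln n))"
  proof -
    have "2 * \<theta> \<le> (1 / 9) * exp (- (c / ln n))"
      using \<theta>1 \<theta>_pos by simp
    also have "\<dots> \<le> exp (- 2) * exp (- (c / ln n))" using e2 by (intro mult_right_mono) auto
    finally show ?thesis by (simp add: exp_add[symmetric])
  qed
  have bad_mean: "(\<Sum>Y\<in>Pow E. mu Y * bad Y) \<le> \<beta>"
  proof -
    have "(\<Sum>Y\<in>Pow E. mu Y * bad Y)
        \<le> (\<Sum>Y\<in>Pow E. mu Y * (\<Sum>A\<in>dense_sets. absent (edge_boundary E A) Y))"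
      using mu_nonneg by (intro sum_mono mult_left_mono bad_le) auto
    also have "\<dots> = (\<Sum>A\<in>dense_sets. \<Sum>Y\<in>Pow E. mu Y * absent (edge_boundary E A) Y)"
      by (subst sum.swap) (simp add: sum_distrib_left)
    also have "\<dots> \<le> (\<Sum>A\<in>dense_sets. (2 * \<theta>) ^ card (edge_boundary E A))"
      by (intro sum_mono sum_mu_absent_le) (auto simp: edge_boundary_def)
    also have "\<dots> \<le> 2 * (\<epsilon> / 8) / n ^ 7"
      using power_boundary_le[of "2 * \<theta>" c] x c n3 \<theta>_pos \<epsilon>
      by (intro dense_sets_sum_le) auto
    finally show ?thesis by (simp only: \<beta>_def)
  qed
  \<comment> \<open>The expected number of discrepancies after \<open>t\<close> coupled steps
    between the chain from \<open>E\<close> and a stationary chain, which always stays below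
    it.\<close>
  define M where "M t = (\<Sum>Y\<in>Pow E. mu Y * (Q ^^ t) D E Y)" for t
  have M_Suc: "M (Suc t) \<le> \<alpha> * M t + \<beta>" for t
  proof -
    have "M (Suc t) \<le> (\<Sum>Y\<in>Pow E. mu Y * (\<alpha> * (Q ^^ t) D E Y + (G ^^ t) bad Y))"
      unfolding M_def \<alpha>_def
    proof (intro sum_mono mult_left_mono)
      fix Y assume "Y \<in> Pow E"
      then show "(Q ^^ Suc t) D E Y \<le> (1 - 1 / (2 * m)) * (Q ^^ t) D E Y + (G ^^ t) bad Y"
        by (intro Q_iter_D_Suc drift[OF K n3(1)]) auto
    qed (use mu_nonneg in auto)
    also have "\<dots> = \<alpha> * M t + (\<Sum>Y\<in>Pow E. mu Y * (G ^^ t) bad Y)"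
      by (simp add: M_def distrib_left sum.distrib sum_distrib_left mult_ac)
    also have "\<dots> \<le> \<alpha> * M t + \<beta>" using bad_mean by (simp add: stationary)
    finally show ?thesis .
  qed
  \<comment> \<open>A stationary configuration misses at most \<open>2 * \<theta> * m\<close> edges
    on average; this small factor later absorbs the loss from rounding \<open>T\<close>
    down.\<close>
  have M0: "M 0 \<le> m * (2 * \<theta>)"
  proof -
    have "M 0 \<le> (\<Sum>Y\<in>Pow E. mu Y * (\<Sum>e\<in>E. absent {e} Y))"
      unfolding M_def using mu_nonneg D_le_absent by (intro sum_mono mult_left_mono) auto
    also have "\<dots> = (\<Sum>e\<in>E. \<Sum>Y\<in>Pow E. mu Y * absent {e} Y)"
      by (subst sum.swap) (simp add: sum_distrib_left)
    also have "\<dots> \<le> (\<Sum>e\<in>E. (2 * \<theta>) ^ card {e})"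
      by (intro sum_mono sum_mu_absent_le) auto
    finally show ?thesis by simp
  qed
  define T where "T = 2 * m * (ln m + ln (2 / \<epsilon>))"
  have T0: "0 \<le> T" unfolding T_def using m \<epsilon> by (intro mult_nonneg_nonneg add_nonneg_nonneg) auto
  \<comment> \<open>Rounding down respects the claimed bound and loses less than one step, which
    \<open>decay\<close> covers by a factor \<open>exp 1 \<le> 3\<close>.\<close>
  define t where "t = nat \<lfloor>T\<rfloor>"
  have t: "real t \<le> T" "T < real t + 1" using T0 by (auto simp: t_def)
  have decay: "\<alpha> ^ t \<le> 3 * (\<epsilon> / (2 * m))"
  proof -
    have "\<alpha> ^ t \<le> exp (- (real t / (2 * m)))"
      unfolding \<alpha>_def using m by (intro one_minus_inverse_power_le) auto
    also have "\<dots> \<le> exp (1 - (ln m + ln (2 / \<epsilon>)))"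
    proof -
      have "2 * m * (ln m + ln (2 / \<epsilon>)) \<le> real t + 2 * m" using t m by (simp add: T_def)
      then have "(ln m + ln (2 / \<epsilon>)) \<le> (real t + 2 * m) / (2 * m)"
        using m by (simp add: field_simps)
      then show ?thesis using m by (simp add: add_divide_distrib)
    qed
    also have "\<dots> = exp 1 * (\<epsilon> / (2 * m))"
      using m \<epsilon> by (simp add: exp_diff exp_add field_simps)
    also have "\<dots> \<le> 3 * (\<epsilon> / (2 * m))" using exp_le \<epsilon> m by (intro mult_right_mono) auto
    finally show ?thesis .
  qed
  have "M t \<le> \<alpha> ^ t * M 0 + \<beta> / (1 - \<alpha>)"
    by (rule affine_recursion_le[where a = M, OF M_Suc \<alpha> \<beta>])
  also have "\<dots> \<le> 3 * (\<epsilon> / (2 * m)) * (m * (2 * \<theta>)) + 2 * (\<epsilon> / 8) / 243"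
  proof (intro add_mono)
    have "\<alpha> ^ t * M 0 \<le> \<alpha> ^ t * (m * (2 * \<theta>))" using M0 \<alpha> by (intro mult_left_mono) auto
    also have "\<dots> \<le> 3 * (\<epsilon> / (2 * m)) * (m * (2 * \<theta>))"
      using decay \<theta>_pos by (intro mult_right_mono) auto
    finally show "\<alpha> ^ t * M 0 \<le> 3 * (\<epsilon> / (2 * m)) * (m * (2 * \<theta>))" .
    show "\<beta> / (1 - \<alpha>) \<le> 2 * (\<epsilon> / 8) / 243"
      unfolding \<beta>_def \<alpha>_def using \<epsilon> by (intro twice_edges_bound n3(2)) auto
  qed
  also have "3 * (\<epsilon> / (2 * m)) * (m * (2 * \<theta>)) = 3 * \<theta> * \<epsilon>" using m by (simp add: field_simps)
  also have "3 * \<theta> * \<epsilon> + 2 * (\<epsilon> / 8) / 243 < \<epsilon>"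
  proof -
    have "3 * \<theta> * \<epsilon> \<le> 1 / 2 * \<epsilon>" using \<theta>5 \<epsilon> by (intro mult_right_mono) auto
    then show ?thesis using \<epsilon>(1) by linarith
  qed
  finally have Mt: "M t < \<epsilon>" .
  have "tv_dist (chain_dist (glauber E \<mu>) t E) \<mu> \<le> (\<Sum>Y\<in>Pow E. mu Y * (Q ^^ t) D E Y)"
  proof (rule tv_dist_chain_le)
    fix A Y assume "Y \<subseteq> E"
    then show "\<bar>(G ^^ t) (indicator A) E - (G ^^ t) (indicator A) Y\<bar> \<le> (Q ^^ t) D E Y"
      using coupling_diff_bound[of "indicator A" 1 Y E t] by (auto simp: indicator_def)
  qed simp
  then have "tv_dist (chain_dist (glauber E \<mu>) t E) \<mu> < \<epsilon>" using Mt by (simp add: M_def)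
  then show ?thesis using t(1) unfolding T_def by blast
qed

lemma fast_mixing:
  assumes m2: "2 \<le> card E" and K: "27 * (\<theta> * ln n) \<le> 1 - L" and K2: "\<theta> * ln n \<le> 1 / 10 ^ 7"
    and \<epsilon>: "0 < \<epsilon>" "\<epsilon> < 1 / 4"
  shows "\<exists>t. real t \<le> 25 * m * ln m * ln (1 / \<epsilon>)
    \<and> (\<forall>X\<subseteq>E. tv_dist (chain_dist (glauber E \<mu>) t X) \<mu> < \<epsilon>)"
proof -
  have n3: "3 \<le> card V" "3 \<le> n" using card_V_ge_3[OF m2] by auto
  have ln1: "1 \<le> ln n" by (rule ln_n_ge_1[OF n3(1)])
  have m: "2 \<le> m" using m2 by simp
  have lnm: "2 / 3 \<le> ln m" using ln2_ge_two_thirds ln_le_cancel_iff[of 2 m] m by linarith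
  define \<alpha> where "\<alpha> = 1 - 1 / (2 * m)"
  have \<alpha>: "0 \<le> \<alpha>" "\<alpha> < 1" using m by (auto simp: \<alpha>_def field_simps)
  define \<beta> where "\<beta> = 2 * 1 / n ^ 7"
  have \<beta>: "0 \<le> \<beta>" by (simp add: \<beta>_def)
  have \<theta>7: "\<theta> \<le> 1 / 10 ^ 7" using K2 mult_left_mono[OF ln1, of \<theta>] \<theta>_pos by linarith
  \<comment> \<open>Burn-in: after \<open>3 * m\<close> steps a given edge was never picked with
    probability at most \<open>exp (- 3)\<close>. From then on \<open>x\<close> is at most
    \<open>2 * exp (- 3) \<le> exp (- 2)\<close>, the base that \<open>power_boundary_le\<close>
    asks for with \<open>c = 0\<close>.\<close>
  define t0 where "t0 = 3 * card E"
  define x where "x t = 2 * \<theta> + (1 - 1 / m) ^ t" for t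
  have x0: "0 \<le> x t" for t using \<theta>_pos m by (auto simp: x_def intro!: add_nonneg_nonneg)
  have e1: "2 \<le> exp (1 :: real)" using exp_ge_add_one_self[of 1] by simp
  have x2: "x (t0 + t) \<le> exp (- 2)" for t
  proof -
    have "(1 - 1 / m) ^ (t0 + t) \<le> exp (- (real (t0 + t) / m))"
      using m by (intro one_minus_inverse_power_le) auto
    also have "\<dots> \<le> exp (- 3)" using m by (simp add: t0_def field_simps)
    finally have "(1 - 1 / m) ^ (t0 + t) \<le> exp (- 3)" .
    moreover have "2 * \<theta> \<le> exp (- 3)"
    proof -
      have "exp (3 :: real) = exp 1 ^ 3" using exp_of_nat_mult[of 3 "1 :: real"] by simp
      also have "\<dots> \<le> 3 ^ 3" using exp_le by (intro power_mono) auto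
      finally have "1 / 27 \<le> exp (- 3 :: real)" by (simp add: exp_minus field_simps)
      then show ?thesis using \<theta>7 by simp
    qed
    moreover have "2 * exp (- 3 :: real) \<le> exp 1 * exp (- 3)"
      using e1 by (intro mult_right_mono) auto
    moreover have "exp 1 * exp (- 3 :: real) = exp (- 2)" by (simp flip: exp_add)
    ultimately show ?thesis unfolding x_def by linarith
  qed
  have absent_le: "(G ^^ t) (absent F) X \<le> x t ^ card F" if "F \<subseteq> E" "X \<subseteq> E" for t F X
    unfolding x_def using flip_prob_range(3) \<theta>_pos that by (intro G_iter_absent_le) auto
  have bad_late: "(G ^^ (t0 + t)) bad X \<le> \<beta>" if X: "X \<subseteq> E" for t X
  proof -
    have "(G ^^ (t0 + t)) bad X
        \<le> (G ^^ (t0 + t)) (\<lambda>Y. \<Sum>A\<in>dense_sets. absent (edge_boundary E A) Y) X"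
      by (intro G_iter_mono bad_le X)
    also have "\<dots> = (\<Sum>A\<in>dense_sets. (G ^^ (t0 + t)) (absent (edge_boundary E A)) X)"
      by (simp only: G_iter_sum)
    also have "\<dots> \<le> (\<Sum>A\<in>dense_sets. x (t0 + t) ^ card (edge_boundary E A))"
      by (intro sum_mono absent_le X) (auto simp: edge_boundary_def)
    also have "\<dots> \<le> 2 * 1 / n ^ 7"
      using power_boundary_le[of "x (t0 + t)" 0] x0 x2 n3 by (intro dense_sets_sum_le) auto
    finally show ?thesis by (simp only: \<beta>_def)
  qed
  \<comment> \<open>At rate \<open>1 - 1 / (2 * m)\<close> these steps gain a factor
    \<open>1 / m ^ 2\<close>, enough against the \<open>m * exp (- 2)\<close> discrepancies left by
    the burn-in.\<close>
  define s where "s = nat \<lceil>4 * m * ln m\<rceil>"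
  have s: "4 * m * ln m \<le> real s" "real s \<le> 4 * m * ln m + 1"
    using m lnm by (auto simp: s_def)
  define t1 where "t1 = t0 + s"
  \<comment> \<open>\<open>oscillation_contraction\<close> doubles this value, so each block of
    \<open>t1\<close> steps shrinks oscillations by \<open>exp (- 1)\<close>. The estimate comes to
    \<open>1 / 8 + 2 / 243\<close>, below \<open>1 / 6 \<le> exp (- 1) / 2\<close>.\<close>
  have contr: "(Q ^^ t1) D E X \<le> exp (- 1) / 2" if X: "X \<subseteq> E" for X
  proof -
    define a where "a r = (Q ^^ (t0 + r)) D E X" for r
    have a_Suc: "a (Suc r) \<le> \<alpha> * a r + \<beta>" for r
    proof -
      have "a (Suc r) \<le> \<alpha> * a r + (G ^^ (t0 + r)) bad X"
        unfolding a_def \<alpha>_def add_Suc_right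
        by (intro Q_iter_D_Suc drift[OF K n3(1)] X order_refl)
      then show ?thesis using bad_late[OF X, of r] by linarith
    qed
    have a0: "a 0 \<le> m * exp (- 2)"
    proof -
      have "a 0 \<le> (Q ^^ t0) (\<lambda>X Y. \<Sum>e\<in>E. absent {e} Y) E X"
        unfolding a_def add_0_right by (intro Q_iter_mono D_le_absent X order_refl)
      also have "\<dots> = (\<Sum>e\<in>E. (G ^^ t0) (absent {e}) X)"
        by (simp only: Q_iter_snd G_iter_sum)
      also have "\<dots> \<le> (\<Sum>e\<in>E. exp (- 2))"
      proof (rule sum_mono)
        fix e assume "e \<in> E"
        then have "(G ^^ t0) (absent {e}) X \<le> x t0 ^ card {e}" using X by (intro absent_le) auto
        then show "(G ^^ t0) (absent {e}) X \<le> exp (- 2)" using x2[of 0] by simp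
      qed
      finally show ?thesis by simp
    qed
    have "a s \<le> \<alpha> ^ s * a 0 + \<beta> / (1 - \<alpha>)"
      by (rule affine_recursion_le[where a = a, OF a_Suc \<alpha> \<beta>])
    also have "\<dots> \<le> exp (- (2 * ln m)) * (m * exp (- 2)) + 2 * 1 / 243"
    proof (intro add_mono)
      have "\<alpha> ^ s \<le> exp (- (real s / (2 * m)))"
        unfolding \<alpha>_def using m by (intro one_minus_inverse_power_le) auto
      also have "\<dots> \<le> exp (- (2 * ln m))" using s(1) m by (simp add: field_simps)
      finally have "\<alpha> ^ s * a 0 \<le> \<alpha> ^ s * (m * exp (- 2))"
        "\<alpha> ^ s * (m * exp (- 2)) \<le> exp (- (2 * ln m)) * (m * exp (- 2))"
        using a0 \<alpha> by (auto intro!: mult_left_mono mult_right_mono)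
      then show "\<alpha> ^ s * a 0 \<le> exp (- (2 * ln m)) * (m * exp (- 2))" by linarith
      show "\<beta> / (1 - \<alpha>) \<le> 2 * 1 / 243"
        unfolding \<beta>_def \<alpha>_def by (intro twice_edges_bound n3(2)) auto
    qed
    also have "exp (- (2 * ln m)) * (m * exp (- 2)) \<le> 1 / 8"
    proof -
      have "exp (- (2 * ln m)) = 1 / m * (1 / m)"
      proof -
        have "exp (- (2 * ln m)) = exp (- ln m) * exp (- ln m)" by (simp flip: exp_add)
        then show ?thesis using m by (simp add: exp_minus inverse_eq_divide)
      qed
      then have "exp (- (2 * ln m)) * (m * exp (- 2)) = 1 / m * exp (- 2)" using m by simp
      also have "\<dots> \<le> 1 / 2 * (1 / 4)"
      proof (intro mult_mono)
        have "exp (2 :: real) = exp 1 * exp 1" by (simp flip: exp_add)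
        moreover have "2 * 2 \<le> exp 1 * exp (1 :: real)" using e1 by (intro mult_mono) auto
        ultimately show "exp (- 2 :: real) \<le> 1 / 4" by (simp add: exp_minus field_simps)
      qed (use m in \<open>auto simp: field_simps\<close>)
      finally show ?thesis by simp
    qed
    also have "1 / 8 + 2 * 1 / 243 \<le> exp (- 1 :: real) / 2"
    proof -
      have "1 / 3 \<le> exp (- 1 :: real)" using exp_le by (simp add: exp_minus field_simps)
      then show ?thesis by simp
    qed
    finally show ?thesis by (simp add: a_def t1_def)
  qed
  define l where "l = ln (1 / \<epsilon>)"
  have l: "1 \<le> l"
  proof -
    have "1 \<le> ln (3 :: real)" using ln3_gt_1 by simp
    also have "\<dots> \<le> ln (1 / \<epsilon>)" using \<epsilon> by (subst ln_le_cancel_iff) (auto simp: field_simps)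
    finally show ?thesis by (simp add: l_def)
  qed
  \<comment> \<open>A block has length at most \<open>12 * m * ln m\<close>, so
    \<open>25 / 12 * l\<close> blocks fit into the claimed bound. Since \<open>l \<ge> 1\<close>,
    rounding down still leaves more than \<open>l\<close> blocks.\<close>
  define k where "k = nat \<lfloor>25 / 12 * l\<rfloor>"
  have k: "real k \<le> 25 / 12 * l" "25 / 12 * l < real k + 1"
  proof -
    have "real k = of_int \<lfloor>25 / 12 * l\<rfloor>" using l by (simp add: k_def)
    then show "real k \<le> 25 / 12 * l" "25 / 12 * l < real k + 1"
      using of_int_floor_le[of "25 / 12 * l"] real_of_int_floor_add_one_gt[of "25 / 12 * l"]
      by linarith+
  qed
  have "l < real k" using k(2) l by linarith
  then have "exp (- real k) < exp (- l)" by simp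
  also have "exp (- l) = \<epsilon>" using \<epsilon> by (simp add: l_def ln_div)
  finally have small: "exp (- real k) < \<epsilon>" .
  have "tv_dist (chain_dist (glauber E \<mu>) (k * t1) X) \<mu> < \<epsilon>" if X: "X \<subseteq> E" for X
  proof -
    have "tv_dist (chain_dist (glauber E \<mu>) (k * t1) X) \<mu> \<le> (\<Sum>Y\<in>Pow E. mu Y * exp (- real k))"
    proof (rule tv_dist_chain_le[OF X])
      fix A Y assume Y: "Y \<subseteq> E"
      have "\<bar>(G ^^ (k * t1)) (indicator A) X - (G ^^ (k * t1)) (indicator A) Y\<bar>
          \<le> (2 * (exp (- 1) / 2)) ^ k * 1"
        using contr X Y by (intro oscillation_contraction) (auto simp: indicator_def)
      also have "(2 * (exp (- 1) / 2)) ^ k * 1 = exp (- real k)"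
        using exp_of_nat_mult[of k "- 1 :: real"] by simp
      finally show "\<bar>(G ^^ (k * t1)) (indicator A) X - (G ^^ (k * t1)) (indicator A) Y\<bar>
          \<le> exp (- real k)" .
    qed
    also have "\<dots> = exp (- real k)" by (simp add: sum_mu flip: sum_distrib_right)
    finally show ?thesis using small by simp
  qed
  moreover have "real (k * t1) \<le> 25 * m * ln m * ln (1 / \<epsilon>)"
  proof -
    \<comment> \<open>\<open>ln m \<ge> 2 / 3\<close> lets the burn-in \<open>3 * m\<close> and the
      rounding of \<open>s\<close> be absorbed into multiples of \<open>m * ln m\<close>.\<close>
    have "m * (2 / 3) \<le> m * ln m" using lnm m by (intro mult_left_mono) auto
    moreover have "real t1 = 3 * m + real s" by (simp add: t1_def t0_def)
    moreover have "real s \<le> 4 * (m * ln m) + 1" using s(2) by (simp only: mult.assoc)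
    ultimately have "real t1 \<le> 12 * (m * ln m)" using m by linarith
    then have "real k * real t1 \<le> 25 / 12 * l * (12 * (m * ln m))"
      using k(1) l by (intro mult_mono) auto
    then show ?thesis by (simp add: l_def mult_ac)
  qed
  ultimately show ?thesis by blast
qed

end

section \<open>Translation into mixing times\<close>

theorem lemma5p1:
  fixes V :: "'v set" and E :: "'v set set"
    and p :: "'v set \<Rightarrow> real" and lam :: "'v \<Rightarrow> real"
    and \<epsilon> pmin lmax K :: real and n m :: nat
    and \<mu> :: "'v set set pmf"
  assumes graph: "simple_graph V E" and nonempty: "E \<noteq> {}"
    and p: "\<And>e. e \<in> E \<Longrightarrow> 0 < p e \<and> p e < 1"
    and lam: "\<And>v. v \<in> V \<Longrightarrow> 0 < lam v \<and> lam v < 1"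
    and eps: "0 < \<epsilon>" "\<epsilon> < 1/4"
  defines "n \<equiv> card V" and "m \<equiv> card E"
    and "pmin \<equiv> Min (p ` E)" and "lmax \<equiv> Max (lam ` V)"
    and "K \<equiv> (1 - pmin) * ln (real n)"
    and "\<mu> \<equiv> random_cluster V E p lam"
  shows "(K \<le> min (1 / 10^7) ((1 - lmax) / 27) \<longrightarrow>
            ereal_of_enat (mixing_time (Pow E) (glauber E \<mu>) \<mu> \<epsilon>)
              \<le> ereal (25 * real m * ln (real m) * ln (1 / \<epsilon>) + 1))
       \<and> (K \<le> min (1 / 10^5 * exp (- (ln (8 / \<epsilon>) / ln (real n)))) ((1 - lmax) / 27) \<longrightarrow>
            ereal_of_enat (mixing_time_from (glauber E \<mu>) \<mu> \<epsilon> E)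
              \<le> ereal (2 * real m * (ln (real m) + ln (2 / \<epsilon>))))"
proof -
  have finE: "finite E" and finV: "finite V"
    using graph finite_edges by (auto simp: simple_graph_def)
  obtain e where e: "e \<in> E" using nonempty by blast
  then have "card e = 2" "e \<subseteq> V" using graph by (auto simp: simple_graph_def)
  then have V_ne: "V \<noteq> {}" by auto
  interpret random_cluster_model V E p lam "1 - pmin" lmax
  proof
    show "1 - p e \<le> 1 - pmin" if "e \<in> E" for e
      using finE that by (simp add: pmin_def)
    show "lam v \<le> lmax" if "v \<in> V" for v
      using finV that by (simp add: lmax_def)
    show "lmax < 1"
      using finV V_ne lam by (simp add: lmax_def)
  qed (use graph nonempty p lam in auto)
  have within: "ereal_of_enat T \<le> ereal b" if "T \<le> enat t" "real t \<le> b" for T t b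
  proof -
    have "ereal_of_enat T \<le> ereal_of_enat (enat t)" using that(1) by (simp only: ereal_of_enat_le_iff)
    also have "\<dots> \<le> ereal b" using that(2) by simp
    finally show ?thesis .
  qed
  have all: "mixing_time (Pow E) (glauber E \<mu>) \<mu> \<epsilon> \<le> enat t"
    if "\<And>X. X \<subseteq> E \<Longrightarrow> tv_dist (chain_dist (glauber E \<mu>) t X) \<mu> < \<epsilon>" for t
    unfolding mixing_time_def using that by (intro SUP_least mixing_time_from_le) auto
  show ?thesis
  \<comment> \<open>For one edge \<open>ln m = 0\<close>: the first bound equals 1 and the second is
    \<open>2 * ln (2 / \<epsilon>) \<ge> 1\<close>. One step, which reaches stationarity exactly,
    meets both.\<close>
  proof (cases "card E = 1")
    case True
    then have single: "tv_dist (chain_dist (glauber E \<mu>) 1 X) \<mu> < \<epsilon>" if "X \<subseteq> E" for X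
      using tv_dist_single_edge[OF True that] eps by (simp add: \<mu>_def)
    have "ln (2 :: real) \<le> ln (2 / \<epsilon>)" using eps by (subst ln_le_cancel_iff) (auto simp: field_simps)
    then have "1 \<le> 2 * ln (2 / \<epsilon>)" using ln2_ge_two_thirds by simp
    then show ?thesis
      using within[OF all[OF single], of "25 * real m * ln (real m) * ln (1 / \<epsilon>) + 1"]
        within[OF mixing_time_from_le[OF single[OF order_refl]],
          of "2 * real m * (ln (real m) + ln (2 / \<epsilon>))"] True
      by (simp add: m_def)
  next
    case False
    have "card E \<noteq> 0" using finE nonempty by simp
    then have m2: "2 \<le> card E" using False by linarith
    show ?thesis
    proof (intro conjI impI)
      assume "K \<le> min (1 / 10^7) ((1 - lmax) / 27)"
      then have "27 * ((1 - pmin) * ln (real (card V))) \<le> 1 - lmax"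
        "(1 - pmin) * ln (real (card V)) \<le> 1 / 10 ^ 7"
        by (auto simp: K_def n_def)
      from fast_mixing[OF m2 this eps] obtain t
        where t: "real t \<le> 25 * real m * ln (real m) * ln (1 / \<epsilon>)"
          "\<And>X. X \<subseteq> E \<Longrightarrow> tv_dist (chain_dist (glauber E \<mu>) t X) \<mu> < \<epsilon>"
        unfolding m_def \<mu>_def by blast
      then show "ereal_of_enat (mixing_time (Pow E) (glauber E \<mu>) \<mu> \<epsilon>)
          \<le> ereal (25 * real m * ln (real m) * ln (1 / \<epsilon>) + 1)"
        by (intro within[OF all[OF t(2)]]) auto
    next
      assume "K \<le> min (1 / 10^5 * exp (- (ln (8 / \<epsilon>) / ln (real n)))) ((1 - lmax) / 27)"
      then have "27 * ((1 - pmin) * ln (real (card V))) \<le> 1 - lmax"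
        "(1 - pmin) * ln (real (card V)) \<le> 1 / 10 ^ 5 * exp (- (ln (8 / \<epsilon>) / ln (real (card V))))"
        by (auto simp: K_def n_def)
      from fast_mixing_from_all_edges[OF m2 this eps] obtain t
        where "real t \<le> 2 * real m * (ln (real m) + ln (2 / \<epsilon>))"
          "tv_dist (chain_dist (glauber E \<mu>) t E) \<mu> < \<epsilon>"
        unfolding m_def \<mu>_def by blast
      then show "ereal_of_enat (mixing_time_from (glauber E \<mu>) \<mu> \<epsilon> E)
          \<le> ereal (2 * real m * (ln (real m) + ln (2 / \<epsilon>)))"
        by (intro within[OF mixing_time_from_le])
    qed
  qed
qed

end
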